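(* Let $P_0,r_0,\delta>0$, and let $\varepsilon_0=\varepsilon_0(P_0,r_0)>0$ be the generalized Margulis constant. Let $(X,\sigma)$ be a $\delta$-hyperbolic GCB-space that is $P_0$-packed at scale $r_0$. Then for every torsion-free, discrete, non-elementary group $\Gamma$ of $\sigma$-isometries of $X$, $$\mathrm{dias}(\Gamma,X)=\sup_{x\in X}\ \inf_{g\in\Gamma\setminus\{1\}}d(x,gx)\ \ge\ \varepsilon_0 .$$
   Context: A geodesic bicombing on a metric space $X$ is a map $\sigma:X\times X\times[0,1]\to X$ such that for all $x,y$ the curve $\sigma_{xy}=\sigma(x,y,\cdot)$ satisfies $\sigma_{xy}(0)=x$, $\sigma_{xy}(1)=y$, $d(\sigma_{xy}(t),\sigma_{xy}(t'))=|t-t'|d(x,y)$. It is convex if $t\mapsto d(\sigma_{xy}(t),\sigma_{x'y'}(t))$ is convex on $[0,1]$ for all $x,y,x',y'$; consistent if $\sigma_{pq}(\lambda)=\sigma_{xy}((1-\lambda)s+\lambda t)$ whenever $0\le s\le t\le1$, $p=\sigma_{xy}(s)$, $q=\sigma_{xy}(t)$, $\lambda\in[0,1]$; reversible if $\sigma_{xy}(t)=\sigma_{yx}(1-t)$. A geodesic segment/ray/line $\gamma$ is a $\sigma$-geodesic if for all $x,y\in\gamma$ the curve $\sigma_{xy}$ parametrizes the subsegment of $\gamma$ from $x$ to $y$. $\sigma$ is geodesically complete if every $\sigma$-geodesic segment is contained in a $\sigma$-geodesic line. A GCB-space is a pair $(X,\sigma)$ with $X$ a complete metric space and $\sigma$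 a geodesically complete, convex, consistent, reversible geodesic bicombing on $X$. A $\sigma$-isometry is an isometry $g$ of $X$ with $\sigma_{g(x)g(y)}=g\circ\sigma_{xy}$ for all $x,y$. $X$ is $P_0$-packed at scale $r_0$ if every closed ball of radius $3r_0$ contains at most $P_0$ points with pairwise distances $>2r_0$. (A GCB-space that is $P_0$-packed at some scale is proper.) A geodesic space $X$ is $\delta$-hyperbolic if $(x,z)_w\ge\min\{(x,y)_w,(y,z)_w\}-\delta$ for all $x,y,z,w\in X$, where $(y,z)_x=\frac12(d(x,y)+d(x,z)-d(y,z))$. $\partial_GX$ is the Gromov boundary. A group $\Gamma$ of isometries of a proper space $X$ is discrete if $\{g\in\Gamma: d(x,gx)\le R\}$ is finite for all $x\in X$, $R\ge0$. The limit set $\Lambda(\Gamma)\subseteq\partial_GX$ is the set of accumulation points of an orbit $\Gamma x$; $\Gamma$ is elementary if $\#\Lambda(\Gamma)\le2$. For $x\in X$, $r\ge0$ let $\Gamma_r(x)$ be the subgroup generated by $\{g\in\Gamma: d(x,gx)\le r\}$, and $\mathrm{nilrad}(\Gamma,x)=\sup\{r\ge0:\Gamma_r(x)\text{ is virtually nilpotent}\}$. Generalized Margulis constant: by a result of Breuillard–Green–Tao, there is $\varepsilon_0=\varepsilon_0(P_0,r_0)>0$ such that for every GCB-space $X$ that is $P_0$-packed at scale $r_0$ and every discrete group $\Gamma$ of isometries of $X$, $\mathrm{nilrad}(\Gamma,x)\ge\varepsilon_0$ for all $x\in X$. Such a constant, depending only on $P_0,r_0$, is fixed once and for all. *)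

theory Defs
  imports
    "HOL-Analysis.Analysis"
    "HOL-Algebra.Bij"
    "HOL-Algebra.Coset"
    "HOL-Algebra.Generated_Groups"
begin

text \<open>
  Metric spaces are given by an explicit carrier \<open>M\<close> and a distance \<open>d\<close>, as in the locale
  \<^locale>\<open>Metric_space\<close>, because the defining property of the Margulis constant quantifies over all
  spaces of a class. Values of \<open>d\<close>, of bicombings and of geodesics outside the relevant domains
  are irrelevant.
\<close>

section \<open>Geodesic bicombings and GCB-spaces\<close>

type_synonym 'a bicombing = "'a \<Rightarrow> 'a \<Rightarrow> real \<Rightarrow> 'a"

definition geodesic_bicombing :: "'a set \<Rightarrow> ('a \<Rightarrow> 'a \<Rightarrow> real) \<Rightarrow> 'a bicombing \<Rightarrow> bool" where
  "geodesic_bicombing M d \<sigma> \<longleftrightarrow>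
     (\<forall>x\<in>M. \<forall>y\<in>M.
        (\<forall>t\<in>{0..1}. \<sigma> x y t \<in> M) \<and> \<sigma> x y 0 = x \<and> \<sigma> x y 1 = y \<and>
        (\<forall>t\<in>{0..1}. \<forall>t'\<in>{0..1}. d (\<sigma> x y t) (\<sigma> x y t') = \<bar>t - t'\<bar> * d x y))"

definition convex_bicombing :: "'a set \<Rightarrow> ('a \<Rightarrow> 'a \<Rightarrow> real) \<Rightarrow> 'a bicombing \<Rightarrow> bool" where
  "convex_bicombing M d \<sigma> \<longleftrightarrow>
     (\<forall>x\<in>M. \<forall>y\<in>M. \<forall>x'\<in>M. \<forall>y'\<in>M. convex_on {0..1} (\<lambda>t. d (\<sigma> x y t) (\<sigma> x' y' t)))"

definition consistent_bicombing :: "'a set \<Rightarrow> 'a bicombing \<Rightarrow> bool" where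
  "consistent_bicombing M \<sigma> \<longleftrightarrow>
     (\<forall>x\<in>M. \<forall>y\<in>M. \<forall>s t l. 0 \<le> s \<and> s \<le> t \<and> t \<le> 1 \<and> 0 \<le> l \<and> l \<le> 1 \<longrightarrow>
        \<sigma> (\<sigma> x y s) (\<sigma> x y t) l = \<sigma> x y ((1 - l) * s + l * t))"

definition reversible_bicombing :: "'a set \<Rightarrow> 'a bicombing \<Rightarrow> bool" where
  "reversible_bicombing M \<sigma> \<longleftrightarrow> (\<forall>x\<in>M. \<forall>y\<in>M. \<forall>t\<in>{0..1}. \<sigma> x y t = \<sigma> y x (1 - t))"

text \<open>
  \<open>I\<close> is the (real) interval of definition: \<open>{a..b}\<close> for segments, \<open>UNIV\<close> for lines. The curve
  \<open>\<sigma> (\<gamma> s) (\<gamma> t)\<close> has constant speed, so it parametrizes the subsegment of \<open>\<gamma>\<close> between its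
  endpoints exactly if it is the affine reparametrization of \<open>\<gamma>\<close> between \<open>s\<close> and \<open>t\<close>.
\<close>
definition sigma_geodesic ::
  "'a set \<Rightarrow> ('a \<Rightarrow> 'a \<Rightarrow> real) \<Rightarrow> 'a bicombing \<Rightarrow> real set \<Rightarrow> (real \<Rightarrow> 'a) \<Rightarrow> bool" where
  "sigma_geodesic M d \<sigma> I \<gamma> \<longleftrightarrow>
     \<gamma> \<in> I \<rightarrow> M \<and>
     (\<forall>s\<in>I. \<forall>t\<in>I. d (\<gamma> s) (\<gamma> t) = \<bar>s - t\<bar>) \<and>
     (\<forall>s\<in>I. \<forall>t\<in>I. \<forall>l\<in>{0..1}. \<sigma> (\<gamma> s) (\<gamma> t) l = \<gamma> ((1 - l) * s + l * t))"

definition geodesically_complete :: "'a set \<Rightarrow> ('a \<Rightarrow> 'a \<Rightarrow> real) \<Rightarrow> 'a bicombing \<Rightarrow> bool" where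
  "geodesically_complete M d \<sigma> \<longleftrightarrow>
     (\<forall>a b \<gamma>. a < b \<and> sigma_geodesic M d \<sigma> {a..b} \<gamma> \<longrightarrow>
        (\<exists>\<gamma>'. sigma_geodesic M d \<sigma> UNIV \<gamma>' \<and> \<gamma> ` {a..b} \<subseteq> range \<gamma>'))"

definition gcb_space :: "'a set \<Rightarrow> ('a \<Rightarrow> 'a \<Rightarrow> real) \<Rightarrow> 'a bicombing \<Rightarrow> bool" where
  "gcb_space M d \<sigma> \<longleftrightarrow>
     Metric_space M d \<and> Metric_space.mcomplete M d \<and>
     geodesic_bicombing M d \<sigma> \<and> convex_bicombing M d \<sigma> \<and> consistent_bicombing M \<sigma> \<and>
     reversible_bicombing M \<sigma> \<and> geodesically_complete M d \<sigma>"

definition packed :: "'a set \<Rightarrow> ('a \<Rightarrow> 'a \<Rightarrow> real) \<Rightarrow> real \<Rightarrow> real \<Rightarrow> bool" where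
  "packed M d P0 r0 \<longleftrightarrow>
     (\<forall>x\<in>M. \<forall>S. S \<subseteq> Metric_space.mcball M d x (3 * r0) \<and> pairwise (\<lambda>y z. d y z > 2 * r0) S
        \<longrightarrow> finite S \<and> real (card S) \<le> P0)"


section \<open>Gromov hyperbolicity and the Gromov boundary\<close>

definition gromov_product :: "('a \<Rightarrow> 'a \<Rightarrow> real) \<Rightarrow> 'a \<Rightarrow> 'a \<Rightarrow> 'a \<Rightarrow> real" where
  "gromov_product d w y z = (d w y + d w z - d y z) / 2"

definition hyperbolic :: "'a set \<Rightarrow> ('a \<Rightarrow> 'a \<Rightarrow> real) \<Rightarrow> real \<Rightarrow> bool" where
  "hyperbolic M d \<delta> \<longleftrightarrow>
     (\<forall>x\<in>M. \<forall>y\<in>M. \<forall>z\<in>M. \<forall>w\<in>M.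
        gromov_product d w x z \<ge> min (gromov_product d w x y) (gromov_product d w y z) - \<delta>)"

text \<open>
  \<open>lim (u\<^sub>m, v\<^sub>n)\<^sub>w = \<infinity>\<close> as \<open>m\<close> and \<open>n\<close> tend to infinity independently; the condition does not
  depend on the base point \<open>w \<in> M\<close>.
\<close>
definition gromov_asymptotic ::
  "'a set \<Rightarrow> ('a \<Rightarrow> 'a \<Rightarrow> real) \<Rightarrow> (nat \<Rightarrow> 'a) \<Rightarrow> (nat \<Rightarrow> 'a) \<Rightarrow> bool" where
  "gromov_asymptotic M d u v \<longleftrightarrow>
     (\<forall>w\<in>M. filterlim (\<lambda>(m, n). gromov_product d w (u m) (v n)) at_top
              (sequentially \<times>\<^sub>F sequentially))"

definition gromov_sequences :: "'a set \<Rightarrow> ('a \<Rightarrow> 'a \<Rightarrow> real) \<Rightarrow> (nat \<Rightarrow> 'a) set" where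
  "gromov_sequences M d = {u. range u \<subseteq> M \<and> gromov_asymptotic M d u u}"

definition gromov_boundary :: "'a set \<Rightarrow> ('a \<Rightarrow> 'a \<Rightarrow> real) \<Rightarrow> (nat \<Rightarrow> 'a) set set" where
  "gromov_boundary M d =
     gromov_sequences M d //
       {(u, v). u \<in> gromov_sequences M d \<and> v \<in> gromov_sequences M d \<and> gromov_asymptotic M d u v}"


section \<open>Discrete groups of isometries\<close>

text \<open>
  The group of surjective isometries of \<open>(M, d)\<close> with composition. As in \<^const>\<open>BijGroup\<close>, its
  elements are extensional, so that they are determined by their values on \<open>M\<close>.
\<close>
definition isometry_group :: "'a set \<Rightarrow> ('a \<Rightarrow> 'a \<Rightarrow> real) \<Rightarrow> ('a \<Rightarrow> 'a) monoid" where
  "isometry_group M d =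
     BijGroup M \<lparr>carrier := {g \<in> Bij M. \<forall>x\<in>M. \<forall>y\<in>M. d (g x) (g y) = d x y}\<rparr>"

lemma group_isometry_group: "group (isometry_group M d)"
proof -
  let ?I = "{g \<in> Bij M. \<forall>x\<in>M. \<forall>y\<in>M. d (g x) (g y) = d x y}"
  have "subgroup ?I (BijGroup M)"
  proof (rule group.subgroupI [OF group_BijGroup])
    show "?I \<subseteq> carrier (BijGroup M)"
      by (auto simp: BijGroup_def)
    have "(\<lambda>x\<in>M. x) \<in> ?I"
      using id_Bij [of M] by auto
    then show "?I \<noteq> {}" by blast
  next
    fix g assume g: "g \<in> ?I"
    then have bij: "bij_betw g M M" by (auto simp: Bij_def)
    have "d (inv_into M g x) (inv_into M g y) = d x y" if "x \<in> M" "y \<in> M" for x y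
    proof -
      have "inv_into M g x \<in> M" "inv_into M g y \<in> M"
        using g that by (auto intro: Bij_inv_into_mem)
      then have "d (g (inv_into M g x)) (g (inv_into M g y)) = d (inv_into M g x) (inv_into M g y)"
        using g by blast
      then show ?thesis
        using bij_betw_inv_into_right [OF bij] that by simp
    qed
    then show "inv\<^bsub>BijGroup M\<^esub> g \<in> ?I"
      using g by (auto simp: inv_BijGroup restrict_inv_into_Bij)
  next
    fix g h assume "g \<in> ?I" "h \<in> ?I"
    moreover from this have "h x \<in> M" if "x \<in> M" for x
      using that by (auto dest: Bij_imp_funcset)
    ultimately show "g \<otimes>\<^bsub>BijGroup M\<^esub> h \<in> ?I"
      by (auto simp: BijGroup_def compose_Bij compose_eq)
  qed
  from group.subgroup_imp_group [OF group_BijGroup this] show ?thesis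
    by (simp add: isometry_group_def)
qed

definition sigma_isometry ::
  "'a set \<Rightarrow> ('a \<Rightarrow> 'a \<Rightarrow> real) \<Rightarrow> 'a bicombing \<Rightarrow> ('a \<Rightarrow> 'a) \<Rightarrow> bool" where
  "sigma_isometry M d \<sigma> g \<longleftrightarrow>
     g \<in> carrier (isometry_group M d) \<and>
     (\<forall>x\<in>M. \<forall>y\<in>M. \<forall>t\<in>{0..1}. \<sigma> (g x) (g y) t = g (\<sigma> x y t))"

definition discrete_group :: "'a set \<Rightarrow> ('a \<Rightarrow> 'a \<Rightarrow> real) \<Rightarrow> ('a \<Rightarrow> 'a) set \<Rightarrow> bool" where
  "discrete_group M d \<Gamma> \<longleftrightarrow>
     subgroup \<Gamma> (isometry_group M d) \<and> (\<forall>x\<in>M. \<forall>R\<ge>0. finite {g \<in> \<Gamma>. d x (g x) \<le> R})"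

definition torsion_free :: "('a, 'b) monoid_scheme \<Rightarrow> bool" where
  "torsion_free G \<longleftrightarrow>
     (\<forall>g\<in>carrier G. g \<noteq> \<one>\<^bsub>G\<^esub> \<longrightarrow> (\<forall>n::nat. n > 0 \<longrightarrow> g [^]\<^bsub>G\<^esub> n \<noteq> \<one>\<^bsub>G\<^esub>))"

text \<open>
  A sequence in \<open>M\<close> converges to a point \<open>\<xi>\<close> of the Gromov boundary exactly if it belongs to the
  class \<open>\<xi>\<close>. As orbit points are never boundary points, the accumulation points of the orbit of \<open>x\<close>
  in the boundary are the limits of sequences of orbit points.
\<close>
definition limit_set ::
  "'a set \<Rightarrow> ('a \<Rightarrow> 'a \<Rightarrow> real) \<Rightarrow> ('a \<Rightarrow> 'a) set \<Rightarrow> 'a \<Rightarrow> (nat \<Rightarrow> 'a) set set" where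
  "limit_set M d \<Gamma> x =
     {\<xi> \<in> gromov_boundary M d. \<exists>g :: nat \<Rightarrow> 'a \<Rightarrow> 'a. range g \<subseteq> \<Gamma> \<and> (\<lambda>n. g n x) \<in> \<xi>}"

text \<open>The limit set is the same for all base points \<open>x \<in> M\<close>.\<close>
definition elementary :: "'a set \<Rightarrow> ('a \<Rightarrow> 'a \<Rightarrow> real) \<Rightarrow> ('a \<Rightarrow> 'a) set \<Rightarrow> bool" where
  "elementary M d \<Gamma> \<longleftrightarrow>
     (\<forall>x\<in>M. finite (limit_set M d \<Gamma> x) \<and> card (limit_set M d \<Gamma> x) \<le> 2)"


section \<open>Virtual nilpotency and the Margulis constant\<close>

primrec lower_central_series :: "('a, 'b) monoid_scheme \<Rightarrow> nat \<Rightarrow> 'a set" where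
  "lower_central_series G 0 = carrier G"
| "lower_central_series G (Suc n) =
     generate G {x \<otimes>\<^bsub>G\<^esub> y \<otimes>\<^bsub>G\<^esub> inv\<^bsub>G\<^esub> x \<otimes>\<^bsub>G\<^esub> inv\<^bsub>G\<^esub> y | x y.
                  x \<in> carrier G \<and> y \<in> lower_central_series G n}"

definition nilpotent_group :: "('a, 'b) monoid_scheme \<Rightarrow> bool" where
  "nilpotent_group G \<longleftrightarrow> (\<exists>n. lower_central_series G n = {\<one>\<^bsub>G\<^esub>})"

definition virtually_nilpotent :: "('a, 'b) monoid_scheme \<Rightarrow> bool" where
  "virtually_nilpotent G \<longleftrightarrow>
     (\<exists>H. subgroup H G \<and> finite (rcosets\<^bsub>G\<^esub> H) \<and> nilpotent_group (G\<lparr>carrier := H\<rparr>))"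

definition short_subgroup ::
  "'a set \<Rightarrow> ('a \<Rightarrow> 'a \<Rightarrow> real) \<Rightarrow> ('a \<Rightarrow> 'a) set \<Rightarrow> real \<Rightarrow> 'a \<Rightarrow> ('a \<Rightarrow> 'a) set" where
  "short_subgroup M d \<Gamma> r x = generate (isometry_group M d) {g \<in> \<Gamma>. d x (g x) \<le> r}"

definition nilrad ::
  "'a set \<Rightarrow> ('a \<Rightarrow> 'a \<Rightarrow> real) \<Rightarrow> ('a \<Rightarrow> 'a) set \<Rightarrow> 'a \<Rightarrow> ereal" where
  "nilrad M d \<Gamma> x =
     (SUP r \<in> {r. r \<ge> 0 \<and> virtually_nilpotent
                   ((isometry_group M d)\<lparr>carrier := short_subgroup M d \<Gamma> r x\<rparr>)}. ereal r)"

text \<open>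
  \<open>\<epsilon>\<close> is a generalized Margulis constant for \<open>P0\<close>, \<open>r0\<close>. The quantification over all GCB-spaces
  is over those whose points belong to the type \<open>'a\<close>. This makes the property weaker than its
  counterpart for all types, hence a theorem assuming it stronger. Packed GCB-spaces are proper, so
  they have at most the cardinality of the continuum, and once \<open>'a\<close> has that cardinality all of
  them occur up to isometry.
\<close>
definition margulis_constant :: "'a itself \<Rightarrow> real \<Rightarrow> real \<Rightarrow> real \<Rightarrow> bool" where
  "margulis_constant (T :: 'a itself) P0 r0 \<epsilon> \<longleftrightarrow>
     \<epsilon> > 0 \<and>
     (\<forall>(M :: 'a set) d \<sigma> \<Gamma>. gcb_space M d \<sigma> \<and> packed M d P0 r0 \<and> discrete_group M d \<Gamma> \<longrightarrow>
        (\<forall>x\<in>M. nilrad M d \<Gamma> x \<ge> ereal \<epsilon>))"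

definition dias ::
  "'a set \<Rightarrow> ('a \<Rightarrow> 'a \<Rightarrow> real) \<Rightarrow> ('a \<Rightarrow> 'a) set \<Rightarrow> ereal" where
  "dias M d \<Gamma> =
     (SUP x\<in>M. INF g \<in> \<Gamma> - {\<one>\<^bsub>isometry_group M d\<^esub>}. ereal (d x (g x)))"

end

theory Submission
  imports Defs "HOL-Library.Diagonal_Subsequence"
begin

text \<open>
  Suppose that every point \<open>x\<close> is moved by less than \<open>\<epsilon>\<^sub>0\<close> by some \<open>g \<noteq> 1\<close> in \<open>\<Gamma>\<close>. Two such short elements at the
  same point lie in a virtually nilpotent group, so powers of them commute with a common \<open>z \<noteq> 1\<close>, and
  the limit points of the orbit of \<open>z\<close> are fixed by these powers. In a torsion-free discrete group,
  elements whose powers share a fixed point at infinity have the same (at most two) fixed points of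
  powers at infinity. Hence short elements at the same point have the same fixed points, and as \<open>M\<close> is
  connected, all short elements have the same set \<open>E\<close> of at most two fixed points. If a boundary point
  \<open>\<eta>\<close> were not in \<open>E\<close>, squares of short elements at points tending to \<open>\<eta>\<close> would have bounded
  displacement at a given base point, because the displacement of an isometry fixing \<open>\<xi> \<in> E\<close> does not essentially
  increase towards \<open>\<xi>\<close>; by discreteness one of them would occur infinitely often and fix \<open>\<eta>\<close>. So the
  whole boundary is contained in \<open>E\<close> and \<open>\<Gamma>\<close> is elementary.
\<close>

section \<open>Sequences converging to boundary points\<close>

context Metric_space
begin

lemma gromov_product_commute: "gromov_product d w x y = gromov_product d w y x"
  by (simp add: gromov_product_def commute)

lemma gromov_product_base_change:
  assumes "w \<in> M" "w' \<in> M" "x \<in> M" "y \<in> M"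
  shows "gromov_product d w x y \<le> gromov_product d w' x y + d w w'"
  using triangle [OF assms(1,2,3)] triangle [OF assms(1,2,4)]
  unfolding gromov_product_def add_divide_distrib diff_divide_distrib by linarith

lemma gromov_product_left_change:
  assumes "w \<in> M" "x \<in> M" "x' \<in> M" "y \<in> M"
  shows "gromov_product d w x y \<le> gromov_product d w x' y + d x x'"
  using assms triangle [of w x' x] triangle [of x' x y]
  by (simp add: gromov_product_def commute field_simps)

lemma gromov_product_sum_bases: "gromov_product d x y z + gromov_product d y x z = d x y"
  by (simp add: gromov_product_def commute field_simps)

lemma gromov_asymptotic_iff_all:
  "gromov_asymptotic M d u v \<longleftrightarrow>
    (\<forall>w\<in>M. \<forall>B. \<exists>N. \<forall>m\<ge>N. \<forall>n\<ge>N. B \<le> gromov_product d w (u m) (v n))"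
  unfolding gromov_asymptotic_def filterlim_at_top eventually_prod_sequentially by simp blast

lemma gromov_asymptoticE:
  assumes "gromov_asymptotic M d u v" "w \<in> M"
  obtains N where "\<And>m n. m \<ge> N \<Longrightarrow> n \<ge> N \<Longrightarrow> B \<le> gromov_product d w (u m) (v n)"
proof -
  have "\<exists>N. \<forall>m\<ge>N. \<forall>n\<ge>N. B \<le> gromov_product d w (u m) (v n)"
    using assms unfolding gromov_asymptotic_iff_all by (elim ballE allE [of _ B]) auto
  then show ?thesis
    using that by blast
qed

text \<open>Gromov products at two base points differ by at most the distance of these points, so
  divergence at a single base point suffices.\<close>

lemma gromov_asymptoticI:
  assumes w: "w \<in> M" and u: "range u \<subseteq> M" and v: "range v \<subseteq> M"
    and *: "\<And>B. \<exists>N. \<forall>m\<ge>N. \<forall>n\<ge>N. B \<le> gromov_product d w (u m) (v n)"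
  shows "gromov_asymptotic M d u v"
  unfolding gromov_asymptotic_iff_all
proof (intro ballI allI)
  fix x B assume x: "x \<in> M"
  obtain N where N: "\<forall>m\<ge>N. \<forall>n\<ge>N. B + d w x \<le> gromov_product d w (u m) (v n)"
    using * [of "B + d w x"] by (elim exE)
  have "B \<le> gromov_product d x (u m) (v n)" if "m \<ge> N" "n \<ge> N" for m n
  proof -
    have "gromov_product d w (u m) (v n) \<le> gromov_product d x (u m) (v n) + d w x"
      using u v by (intro gromov_product_base_change w x) auto
    moreover have "B + d w x \<le> gromov_product d w (u m) (v n)"
      using N that by blast
    ultimately show ?thesis by linarith
  qed
  then show "\<exists>N. \<forall>m\<ge>N. \<forall>n\<ge>N. B \<le> gromov_product d x (u m) (v n)" by blast
qed

lemma gromov_asymptotic_sym: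
  assumes "gromov_asymptotic M d u v"
  shows "gromov_asymptotic M d v u"
  unfolding gromov_asymptotic_iff_all
proof (intro ballI allI)
  fix x B assume "x \<in> M"
  then obtain N where "\<And>m n. m \<ge> N \<Longrightarrow> n \<ge> N \<Longrightarrow> B \<le> gromov_product d x (u m) (v n)"
    using gromov_asymptoticE [OF assms] by meson
  then show "\<exists>N. \<forall>m\<ge>N. \<forall>n\<ge>N. B \<le> gromov_product d x (v m) (u n)"
    using gromov_product_commute by metis
qed

lemma gromov_sequencesD: "u \<in> gromov_sequences M d \<Longrightarrow> u n \<in> M"
  by (auto simp: gromov_sequences_def)

lemma gromov_sequences_range: "u \<in> gromov_sequences M d \<Longrightarrow> range u \<subseteq> M"
  by (simp add: gromov_sequences_def)

lemma gromov_sequences_asymptotic_refl: "u \<in> gromov_sequences M d \<Longrightarrow> gromov_asymptotic M d u u"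
  by (simp add: gromov_sequences_def)

text \<open>Replacing \<open>u n\<close> by \<open>v n\<close> changes Gromov products by at most
  \<open>B\<close>. This applies when an isometry moves all terms of a sequence by a bounded
  amount.\<close>

lemma gromov_asymptotic_if_bounded:
  assumes u: "u \<in> gromov_sequences M d" and v: "range v \<subseteq> M" and B: "\<And>n. d (u n) (v n) \<le> B"
  shows "gromov_asymptotic M d u v"
proof -
  obtain w where w: "w \<in> M" using v by auto
  show ?thesis
  proof (rule gromov_asymptoticI [OF w gromov_sequences_range [OF u] v])
    fix A
    obtain N where N: "\<And>m n. m \<ge> N \<Longrightarrow> n \<ge> N \<Longrightarrow> A + B \<le> gromov_product d w (u m) (u n)"
      using gromov_asymptoticE [OF gromov_sequences_asymptotic_refl [OF u] w] by metis
    have "A \<le> gromov_product d w (u m) (v n)" if "m \<ge> N" "n \<ge> N" for m n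
    proof -
      have "gromov_product d w (u n) (u m) \<le> gromov_product d w (v n) (u m) + d (u n) (v n)"
        using v gromov_sequencesD [OF u] by (intro gromov_product_left_change w) auto
      moreover have "A + B \<le> gromov_product d w (u n) (u m)"
        using N that by blast
      ultimately show ?thesis
        using B [of n] gromov_product_commute [of w "u m" "v n"] by linarith
    qed
    then show "\<exists>N. \<forall>m\<ge>N. \<forall>n\<ge>N. A \<le> gromov_product d w (u m) (v n)" by blast
  qed
qed

end

section \<open>Consequences of the hyperbolicity inequality\<close>

locale gromov_hyperbolic = Metric_space M d for M :: "'a set" and d +
  fixes \<delta> :: real
  assumes hyperbolic: "hyperbolic M d \<delta>"
begin

lemma gromov_product_hyperbolic:
  assumes "w \<in> M" "x \<in> M" "y \<in> M" "z \<in> M"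
  shows "min (gromov_product d w x y) (gromov_product d w y z) \<le> gromov_product d w x z + \<delta>"
proof -
  have "min (gromov_product d w x y) (gromov_product d w y z) - \<delta> \<le> gromov_product d w x z"
    using hyperbolic assms unfolding hyperbolic_def by blast
  then show ?thesis by simp
qed

text \<open>Clearing the distances to \<open>w\<close> from the hyperbolicity inequality gives the
  symmetric form on the three pairings of four points.\<close>

lemma four_point:
  assumes "w \<in> M" "x \<in> M" "y \<in> M" "z \<in> M"
  shows "d x z + d y w \<le> max (d x y + d z w) (d y z + d x w) + 2 * \<delta>"
  using gromov_product_hyperbolic [OF assms] commute [of w x] commute [of w y] commute [of w z]
    max.cobounded1 [of "d x y + d z w" "d y z + d x w"] max.cobounded2 [of "d y z + d x w" "d x y + d z w"]
  unfolding gromov_product_def add_divide_distrib diff_divide_distrib min_le_iff_disj by linarith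

lemma delta_nonneg: "x \<in> M \<Longrightarrow> 0 \<le> \<delta>"
  using gromov_product_hyperbolic [of x x x x] by simp

lemma gromov_asymptotic_trans:
  assumes uv: "gromov_asymptotic M d u v" and vw: "gromov_asymptotic M d v w"
    and M: "range u \<subseteq> M" "range v \<subseteq> M" "range w \<subseteq> M"
  shows "gromov_asymptotic M d u w"
proof -
  obtain x where x: "x \<in> M" using M by auto
  show ?thesis
  proof (rule gromov_asymptoticI [OF x M(1,3)])
    fix B
    obtain N1 where N1: "\<And>m n. m \<ge> N1 \<Longrightarrow> n \<ge> N1 \<Longrightarrow> B + \<delta> \<le> gromov_product d x (u m) (v n)"
      using gromov_asymptoticE [OF uv x] by metis
    obtain N2 where N2: "\<And>m n. m \<ge> N2 \<Longrightarrow> n \<ge> N2 \<Longrightarrow> B + \<delta> \<le> gromov_product d x (v m) (w n)"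
      using gromov_asymptoticE [OF vw x] by metis
    have "B \<le> gromov_product d x (u m) (w n)" if "m \<ge> max N1 N2" "n \<ge> max N1 N2" for m n
    proof -
      have "u m \<in> M" "v n \<in> M" "w n \<in> M"
        using M by auto
      moreover have "B + \<delta> \<le> gromov_product d x (u m) (v n)" "B + \<delta> \<le> gromov_product d x (v n) (w n)"
        using N1 N2 that by auto
      ultimately show ?thesis
        using gromov_product_hyperbolic [OF x, of "u m" "v n" "w n"] by linarith
    qed
    then show "\<exists>N. \<forall>m\<ge>N. \<forall>n\<ge>N. B \<le> gromov_product d x (u m) (w n)" by blast
  qed
qed

text \<open>Changing the sequence that represents a boundary point costs one \<open>\<delta>\<close>
  in a bound on Gromov products.\<close>

lemma eventually_gromov_product_asymptotic:
  assumes uv: "gromov_asymptotic M d u v" and M: "range u \<subseteq> M" "range v \<subseteq> M" "x \<in> M" "y \<in> M"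
    and ev: "\<forall>\<^sub>F n in sequentially. gromov_product d x y (u n) \<le> D"
  shows "\<forall>\<^sub>F n in sequentially. gromov_product d x y (v n) \<le> D + \<delta>"
proof -
  \<comment> \<open>The threshold exceeds \<open>D + \<delta>\<close>, so in the hyperbolicity
    inequality through \<open>v n\<close> the minimum must be the product of \<open>y\<close> and
    \<open>v n\<close>.\<close>
  obtain N where N: "\<And>m n. m \<ge> N \<Longrightarrow> n \<ge> N \<Longrightarrow> D + 2 * \<delta> + 1 \<le> gromov_product d x (u m) (v n)"
    using gromov_asymptoticE [OF uv M(3)] by metis
  then have "\<forall>\<^sub>F n in sequentially. D + 2 * \<delta> + 1 \<le> gromov_product d x (u n) (v n)"
    unfolding eventually_sequentially by blast
  with ev show ?thesis
  proof eventually_elim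
    case (elim n)
    moreover have "u n \<in> M" "v n \<in> M"
      using M by auto
    ultimately show ?case
      using gromov_product_hyperbolic [OF M(3,4), of "v n" "u n"] delta_nonneg [OF M(3)]
        gromov_product_commute [of x "u n" "v n"] by linarith
  qed
qed

text \<open>Late terms of \<open>u\<close> have large products with each other, so a bound at one
  late term carries over to all of them. This upgrades alternatives that are known only for each
  \<open>n\<close> separately.\<close>

lemma gromov_product_frequently_imp_eventually:
  assumes u: "u \<in> gromov_sequences M d" and M: "x \<in> M" "y \<in> M"
    and fr: "\<exists>\<^sub>F n in sequentially. gromov_product d x y (u n) \<le> D"
  shows "\<forall>\<^sub>F n in sequentially. gromov_product d x y (u n) \<le> D + \<delta>"
proof -
  obtain N where N: "\<And>m n. m \<ge> N \<Longrightarrow> n \<ge> N \<Longrightarrow> D + \<delta> + 1 \<le> gromov_product d x (u m) (u n)"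
    using gromov_asymptoticE [OF gromov_sequences_asymptotic_refl [OF u] M(1)] by metis
  obtain m where m: "m \<ge> N" "gromov_product d x y (u m) \<le> D"
    using fr unfolding frequently_sequentially by blast
  have "gromov_product d x y (u n) \<le> D + \<delta>" if "n \<ge> N" for n
  proof -
    have "D + \<delta> + 1 \<le> gromov_product d x (u n) (u m)"
      using N m(1) that by blast
    then show ?thesis
      using gromov_product_hyperbolic [OF M gromov_sequencesD [OF u] gromov_sequencesD [OF u], of n m]
        m(2) delta_nonneg [OF M(1)] by linarith
  qed
  then show ?thesis
    unfolding eventually_sequentially by blast
qed

text \<open>Failure of divergence only gives arbitrarily late pairs with product below some
  \<open>B\<close>. Two hyperbolicity steps, one along each sequence, spread the bound from one such
  pair to all late pairs.\<close>

lemma gromov_product_bounded_if_not_asymptotic: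
  assumes u: "u \<in> gromov_sequences M d" and v: "v \<in> gromov_sequences M d"
    and uv: "\<not> gromov_asymptotic M d u v" and w: "w \<in> M"
  shows "\<exists>D. \<exists>N. \<forall>m\<ge>N. \<forall>n\<ge>N. gromov_product d w (u m) (v n) \<le> D"
proof -
  note UM = gromov_sequencesD [OF u] and VM = gromov_sequencesD [OF v]
  have "\<exists>B. \<forall>N. \<exists>m\<ge>N. \<exists>n\<ge>N. gromov_product d w (u m) (v n) < B"
    using uv gromov_asymptoticI [OF w gromov_sequences_range [OF u] gromov_sequences_range [OF v]]
    by (meson not_le)
  then obtain B where B: "\<forall>N. \<exists>m\<ge>N. \<exists>n\<ge>N. gromov_product d w (u m) (v n) < B" ..
  obtain N1 where N1: "\<And>m n. m \<ge> N1 \<Longrightarrow> n \<ge> N1 \<Longrightarrow> B + 2 * \<delta> \<le> gromov_product d w (u m) (u n)"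
    using gromov_asymptoticE [OF gromov_sequences_asymptotic_refl [OF u] w] by metis
  obtain N2 where N2: "\<And>m n. m \<ge> N2 \<Longrightarrow> n \<ge> N2 \<Longrightarrow> B + 2 * \<delta> \<le> gromov_product d w (v m) (v n)"
    using gromov_asymptoticE [OF gromov_sequences_asymptotic_refl [OF v] w] by metis
  let ?N = "max N1 N2"
  obtain m' n' where mn': "m' \<ge> ?N" "n' \<ge> ?N" "gromov_product d w (u m') (v n') < B"
    using B by blast
  have "gromov_product d w (u m) (v n) \<le> B + 2 * \<delta>" if "m \<ge> ?N" "n \<ge> ?N" for m n
  proof (rule ccontr)
    assume A: "\<not> ?thesis"
    have "B + 2 * \<delta> \<le> gromov_product d w (u m') (u m)" "B + 2 * \<delta> \<le> gromov_product d w (v n) (v n')"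
      using N1 N2 that mn' by auto
    then show False
      using A mn'(3) delta_nonneg [OF w] gromov_product_hyperbolic [OF w UM UM VM, of m' m n]
        gromov_product_hyperbolic [OF w UM VM VM, of m' n n'] by linarith
  qed
  then show ?thesis by blast
qed

text \<open>At most one of \<open>a\<close>, \<open>b\<close>, \<open>c\<close> has a large product
  with \<open>y\<close> at \<open>x\<close>, and at most one has a large product with
  \<open>x\<close> at \<open>y\<close>. Some \<open>p\<close> among the three is good for both, and
  the two products add up to \<open>d x y\<close>.\<close>

lemma dist_le_if_three_gromov_products_le:
  assumes M: "x \<in> M" "y \<in> M" "a \<in> M" "b \<in> M" "c \<in> M"
    and x: "gromov_product d x a b \<le> D" "gromov_product d x b c \<le> D" "gromov_product d x a c \<le> D"
    and y: "gromov_product d y a b \<le> E" "gromov_product d y b c \<le> E" "gromov_product d y a c \<le> E"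
  shows "d x y \<le> D + E + 2 * \<delta>"
proof -
  have *: "gromov_product d x y p \<le> D + \<delta> \<or> gromov_product d x y q \<le> D + \<delta>"
    if "gromov_product d x p q \<le> D" "x \<in> M" "y \<in> M" "p \<in> M" "q \<in> M" for x y p q D
    using gromov_product_hyperbolic [of x p y q] that gromov_product_commute [of x p y] by linarith
  have "gromov_product d x y p \<le> D + \<delta> \<and> gromov_product d y x p \<le> E + \<delta> \<Longrightarrow> ?thesis" for p
    using gromov_product_sum_bases [of x y p] by linarith
  moreover note * [OF x(1) M(1,2,3,4)] * [OF x(2) M(1,2,4,5)] * [OF x(3) M(1,2,3,5)]
    * [OF y(1) M(2,1,3,4)] * [OF y(2) M(2,1,4,5)] * [OF y(3) M(2,1,3,5)]
  ultimately show ?thesis by blast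
qed

text \<open>
  The bound \<open>D\<close> says that \<open>x\<close> lies near a geodesic from \<open>y\<close> to the limit of \<open>u\<close>, which \<open>g\<close> fixes.
  This estimate replaces the convexity of the displacement function along rays.
\<close>
lemma displacement_bound:
  assumes g: "g ` M \<subseteq> M" "\<And>a b. a \<in> M \<Longrightarrow> b \<in> M \<Longrightarrow> d (g a) (g b) = d a b"
    and u: "u \<in> gromov_sequences M d" and gu: "gromov_asymptotic M d (g \<circ> u) u"
    and M: "x \<in> M" "y \<in> M"
    and D: "\<forall>\<^sub>F n in sequentially. gromov_product d x y (u n) \<le> D"
    and \<epsilon>: "d y (g y) \<le> \<epsilon>"
  shows "d x (g x) \<le> 2 * D + 3 * \<epsilon> + 4 * \<delta>"
proof -
  have gM: "g x \<in> M" "g y \<in> M" "range (g \<circ> u) \<subseteq> M"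
    using g M gromov_sequencesD [OF u] by auto
  have "gromov_product d (g x) (g y) ((g \<circ> u) n) = gromov_product d x y (u n)" for n
    using g M gromov_sequencesD [OF u] by (simp add: gromov_product_def)
  then have "\<forall>\<^sub>F n in sequentially. gromov_product d (g x) (g y) (u n) \<le> D + \<delta>"
    using D
    by (intro eventually_gromov_product_asymptotic [OF gu gM(3) gromov_sequences_range [OF u] gM(1,2)]) simp
  with D have "\<forall>\<^sub>F n in sequentially. d x (g x) \<le> 2 * D + 3 * \<epsilon> + 4 * \<delta>"
  proof eventually_elim
    case (elim n)
    let ?u = "u n"
    have u: "?u \<in> M" by (rule gromov_sequencesD [OF u])
    have "gromov_product d (g x) y ?u \<le> D + \<delta> + \<epsilon>"
      using gromov_product_left_change [OF gM(1) M(2) gM(2) u] elim \<epsilon> by linarith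
    moreover have "d x y = d (g x) (g y)"
      using g M by simp
    \<comment> \<open>Both alternatives bound \<open>d x (g x)\<close> through a Gromov product of
      \<open>y\<close> and \<open>u n\<close>: the first at \<open>g x\<close>, the second at
      \<open>x\<close>. The first gives the larger constant.\<close>
    moreover have "d x (g x) + d y ?u \<le> d x y + d (g x) ?u + 2 * \<delta> \<or>
        d x (g x) + d y ?u \<le> d y (g x) + d x ?u + 2 * \<delta>"
      using four_point [OF u M(1,2) gM(1)] by (auto simp: max_def split: if_splits)
    ultimately show ?case
      using elim(1) \<epsilon> nonneg [of y "g y"] delta_nonneg [OF M(1)]
        triangle [OF gM(1) M(2) gM(2)] triangle [OF gM(1) gM(2) M(2)]
        commute [of x y] commute [of "g x" y] commute [of "g y" y]
      unfolding gromov_product_def add_divide_distrib diff_divide_distrib by linarith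
  qed
  then show ?thesis by simp
qed

end

section \<open>Torsion-free discrete groups of isometries\<close>

text \<open>The axioms describe the action on points of \<open>M\<close> only, since elements of
  \<open>isometry_group\<close> are extensional. In \<open>discrete\<close> the radius may be
  negative: the set is then empty.\<close>

locale hyperbolic_isometry_group = gromov_hyperbolic M d \<delta> + group G
  for M :: "'a set" and d and \<delta> and G :: "('a \<Rightarrow> 'a, 'b) monoid_scheme" (structure) +
  assumes maps: "g \<in> carrier G \<Longrightarrow> x \<in> M \<Longrightarrow> g x \<in> M"
    and isometric: "g \<in> carrier G \<Longrightarrow> x \<in> M \<Longrightarrow> y \<in> M \<Longrightarrow> d (g x) (g y) = d x y"
    and one_apply: "x \<in> M \<Longrightarrow> \<one> x = x"
    and mult_apply: "g \<in> carrier G \<Longrightarrow> h \<in> carrier G \<Longrightarrow> x \<in> M \<Longrightarrow> (g \<otimes> h) x = g (h x)"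
    and discrete: "x \<in> M \<Longrightarrow> finite {g \<in> carrier G. d x (g x) \<le> R}"
    and torsion_free: "torsion_free G"
begin

lemma inv_apply: "g \<in> carrier G \<Longrightarrow> x \<in> M \<Longrightarrow> (inv g) (g x) = x"
  by (metis inv_closed l_inv mult_apply one_apply)

lemma pow_neq_one: "g \<in> carrier G \<Longrightarrow> g \<noteq> \<one> \<Longrightarrow> (0::nat) < k \<Longrightarrow> g [^] k \<noteq> \<one>"
  using torsion_free unfolding torsion_free_def by blast

lemma inj_pow:
  assumes g: "g \<in> carrier G" "g \<noteq> \<one>"
  shows "inj (\<lambda>n::nat. g [^] n)"
proof (rule linorder_injI)
  fix i j :: nat assume "i < j"
  then have "g [^] j = g [^] i \<otimes> g [^] (j - i)"
    using g by (simp add: nat_pow_mult)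
  moreover have "g [^] (j - i) \<noteq> \<one>"
    using pow_neq_one g \<open>i < j\<close> by simp
  ultimately show "g [^] i \<noteq> g [^] j"
    using g by simp
qed

text \<open>Expresses that \<open>g\<close> fixes the boundary point represented by
  \<open>u\<close>.\<close>

definition stabilizes :: "('a \<Rightarrow> 'a) \<Rightarrow> (nat \<Rightarrow> 'a) \<Rightarrow> bool" where
  "stabilizes g u \<longleftrightarrow> gromov_asymptotic M d (g \<circ> u) u"

text \<open>
  Boundary points are represented by the sequences converging to them. Passing to powers
  makes the fixed points at infinity an invariant of the commensurability class of \<open>g\<close>.
\<close>
definition ends :: "('a \<Rightarrow> 'a) \<Rightarrow> (nat \<Rightarrow> 'a) set" where
  "ends g = {u \<in> gromov_sequences M d. \<exists>k::nat. 0 < k \<and> stabilizes (g [^] k) u}"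

section \<open>The action on boundary points\<close>

lemma gromov_product_apply:
  "g \<in> carrier G \<Longrightarrow> w \<in> M \<Longrightarrow> x \<in> M \<Longrightarrow> y \<in> M \<Longrightarrow>
    gromov_product d (g w) (g x) (g y) = gromov_product d w x y"
  by (simp add: gromov_product_def isometric)

lemma range_apply: "g \<in> carrier G \<Longrightarrow> u \<in> gromov_sequences M d \<Longrightarrow> range (g \<circ> u) \<subseteq> M"
  using maps gromov_sequencesD by fastforce

lemma asymptotic_apply:
  assumes g: "g \<in> carrier G" and uv: "gromov_asymptotic M d u v" "range u \<subseteq> M" "range v \<subseteq> M"
  shows "gromov_asymptotic M d (g \<circ> u) (g \<circ> v)"
proof -
  obtain w where w: "w \<in> M" using uv by auto
  have "gromov_product d (g w) ((g \<circ> u) m) ((g \<circ> v) n) = gromov_product d w (u m) (v n)" for m n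
    using g w uv by (auto intro!: gromov_product_apply)
  moreover have "\<exists>N. \<forall>m\<ge>N. \<forall>n\<ge>N. B \<le> gromov_product d w (u m) (v n)" for B
    using gromov_asymptoticE [OF uv(1) w] by metis
  moreover have "range (g \<circ> u) \<subseteq> M" "range (g \<circ> v) \<subseteq> M"
    using uv maps [OF g] by auto
  ultimately show ?thesis
    by (intro gromov_asymptoticI [OF maps [OF g w]]) simp_all
qed

lemma gromov_sequences_apply:
  "g \<in> carrier G \<Longrightarrow> u \<in> gromov_sequences M d \<Longrightarrow> g \<circ> u \<in> gromov_sequences M d"
  using asymptotic_apply [of g u u] range_apply [of g u] by (simp add: gromov_sequences_def)

lemma asymptotic_trans:
  assumes "gromov_asymptotic M d u v" "gromov_asymptotic M d v w"
    and "u \<in> gromov_sequences M d" "v \<in> gromov_sequences M d" "w \<in> gromov_sequences M d"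
  shows "gromov_asymptotic M d u w"
  by (rule gromov_asymptotic_trans [OF assms(1,2) assms(3-5) [THEN gromov_sequences_range]])

lemma stabilizes_one: "u \<in> gromov_sequences M d \<Longrightarrow> stabilizes \<one> u"
proof -
  assume u: "u \<in> gromov_sequences M d"
  then have "\<one> \<circ> u = u"
    using one_apply gromov_sequencesD by fastforce
  then show ?thesis
    using u by (simp add: stabilizes_def gromov_sequences_def)
qed

lemma stabilizes_mult:
  assumes gh: "g \<in> carrier G" "h \<in> carrier G" and u: "u \<in> gromov_sequences M d"
    and s: "stabilizes g u" "stabilizes h u"
  shows "stabilizes (g \<otimes> h) u"
proof -
  have "(g \<otimes> h) \<circ> u = g \<circ> (h \<circ> u)"
    using gh gromov_sequencesD [OF u] by (auto simp: mult_apply)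
  moreover have "gromov_asymptotic M d (g \<circ> (h \<circ> u)) (g \<circ> u)"
    using s gh u range_apply gromov_sequences_range by (intro asymptotic_apply) (auto simp: stabilizes_def)
  ultimately show ?thesis
    using asymptotic_trans [of "g \<circ> (h \<circ> u)" "g \<circ> u" u] s u
      gromov_sequences_apply [OF gh(1)] gromov_sequences_apply [OF gh(2)]
    by (simp add: stabilizes_def)
qed

lemma stabilizes_inv:
  assumes g: "g \<in> carrier G" and u: "u \<in> gromov_sequences M d" and s: "stabilizes g u"
  shows "stabilizes (inv g) u"
proof -
  have "inv g \<circ> (g \<circ> u) = u"
    using g gromov_sequencesD [OF u] by (auto simp: inv_apply)
  moreover have "gromov_asymptotic M d (inv g \<circ> (g \<circ> u)) (inv g \<circ> u)"
    using s g u range_apply gromov_sequences_range by (intro asymptotic_apply) (auto simp: stabilizes_def)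
  ultimately show ?thesis
    by (simp add: stabilizes_def gromov_asymptotic_sym)
qed

lemma stabilizes_pow:
  assumes "g \<in> carrier G" "u \<in> gromov_sequences M d" "stabilizes g u"
  shows "stabilizes (g [^] (n::nat)) u"
  by (induction n) (use assms in \<open>auto intro: stabilizes_one stabilizes_mult\<close>)

lemma stabilizes_cong:
  assumes g: "g \<in> carrier G" and u: "u \<in> gromov_sequences M d" and v: "v \<in> gromov_sequences M d"
    and uv: "gromov_asymptotic M d u v" and s: "stabilizes g u"
  shows "stabilizes g v"
proof -
  have "gromov_asymptotic M d (g \<circ> v) (g \<circ> u)"
    using asymptotic_apply [OF g gromov_asymptotic_sym [OF uv]] u v gromov_sequences_range by blast
  moreover have "gromov_asymptotic M d (g \<circ> u) v"
    using asymptotic_trans [OF s [unfolded stabilizes_def] uv] gromov_sequences_apply [OF g] u v by blast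
  ultimately show ?thesis
    using asymptotic_trans [of "g \<circ> v" "g \<circ> u" v] gromov_sequences_apply [OF g] u v
    unfolding stabilizes_def by blast
qed

lemma endsD: "u \<in> ends g \<Longrightarrow> u \<in> gromov_sequences M d"
  by (simp add: ends_def)

lemma ends_cong:
  assumes "g \<in> carrier G" "u \<in> ends g" "v \<in> gromov_sequences M d" "gromov_asymptotic M d u v"
  shows "v \<in> ends g"
  using assms stabilizes_cong [of _ u v] unfolding ends_def by auto

text \<open>The product of \<open>g (u n)\<close> and \<open>g (v n)\<close> at \<open>g x\<close>
  equals that of \<open>u n\<close> and \<open>v n\<close> at \<open>x\<close>. Returning to
  \<open>u n\<close> and \<open>v n\<close> costs one \<open>\<delta>\<close> each, because
  \<open>g\<close> fixes both limits.\<close>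

lemma eventually_translated_product_le:
  assumes g: "g \<in> carrier G" and x: "x \<in> M"
    and u: "u \<in> gromov_sequences M d" and v: "v \<in> gromov_sequences M d"
    and s: "stabilizes g u" "stabilizes g v"
    and D: "\<forall>\<^sub>F n in sequentially. gromov_product d x (u n) (v n) \<le> D"
  shows "\<forall>\<^sub>F n in sequentially. gromov_product d (g x) (u n) (v n) \<le> D + 2 * \<delta>"
proof -
  let ?y = "g x"
  have y: "?y \<in> M" using maps g x by blast
  have large: "\<forall>\<^sub>F n in sequentially. D + 2 * \<delta> + 1 \<le> gromov_product d ?y ((g \<circ> w) n) (w n)"
    if w: "stabilizes g w" for w
  proof -
    obtain N where "\<And>m n. m \<ge> N \<Longrightarrow> n \<ge> N \<Longrightarrow> D + 2 * \<delta> + 1 \<le> gromov_product d ?y ((g \<circ> w) m) (w n)"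
      using gromov_asymptoticE [OF w [unfolded stabilizes_def] y] by metis
    then show ?thesis
      unfolding eventually_sequentially by blast
  qed
  from D large [OF s(1)] large [OF s(2)] show ?thesis
  proof eventually_elim
    case (elim n)
    have M: "u n \<in> M" "v n \<in> M" "g (u n) \<in> M" "g (v n) \<in> M"
      using u v g maps gromov_sequencesD by auto
    have "gromov_product d ?y (g (u n)) (g (v n)) \<le> D"
      using elim(1) gromov_product_apply [OF g x M(1,2)] by simp
    then show ?case
      using elim(2,3) gromov_product_hyperbolic [OF y M(3,1,2)] gromov_product_hyperbolic [OF y M(3,2,4)]
        gromov_product_commute [of ?y "g (v n)" "v n"] delta_nonneg [OF x] by simp
  qed
qed

text \<open>
  Isometries that fix three boundary points coarsely fix the centre of the ideal triangle they span.
\<close>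
lemma finite_stabilizer_of_triple:
  assumes u: "u \<in> gromov_sequences M d" and v: "v \<in> gromov_sequences M d" and w: "w \<in> gromov_sequences M d"
    and uv: "\<not> gromov_asymptotic M d u v" and vw: "\<not> gromov_asymptotic M d v w"
    and uw: "\<not> gromov_asymptotic M d u w"
  shows "finite {g \<in> carrier G. stabilizes g u \<and> stabilizes g v \<and> stabilizes g w}"
proof -
  define x where "x = u 0"
  have x: "x \<in> M" by (simp add: x_def gromov_sequencesD u)
  have ev: "\<exists>D. \<forall>\<^sub>F n in sequentially. gromov_product d x (a n) (b n) \<le> D"
    if ab: "a \<in> gromov_sequences M d" "b \<in> gromov_sequences M d" "\<not> gromov_asymptotic M d a b" for a b
    using gromov_product_bounded_if_not_asymptotic [OF ab x] unfolding eventually_sequentially by blast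
  obtain D1 D2 D3 where D123:
    "\<forall>\<^sub>F n in sequentially. gromov_product d x (u n) (v n) \<le> D1"
    "\<forall>\<^sub>F n in sequentially. gromov_product d x (v n) (w n) \<le> D2"
    "\<forall>\<^sub>F n in sequentially. gromov_product d x (u n) (w n) \<le> D3"
    using ev [OF u v uv] ev [OF v w vw] ev [OF u w uw] by blast
  define D where "D = max D1 (max D2 D3)"
  have D: "\<forall>\<^sub>F n in sequentially. gromov_product d x (u n) (v n) \<le> D"
    "\<forall>\<^sub>F n in sequentially. gromov_product d x (v n) (w n) \<le> D"
    "\<forall>\<^sub>F n in sequentially. gromov_product d x (u n) (w n) \<le> D"
    by (rule eventually_mono [OF D123(1)] eventually_mono [OF D123(2)] eventually_mono [OF D123(3)],
        simp add: D_def)+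
  have "d x (g x) \<le> 2 * D + 4 * \<delta>"
    if g: "g \<in> carrier G" and s: "stabilizes g u" "stabilizes g v" "stabilizes g w" for g
  proof -
    note tr = eventually_translated_product_le [OF g x]
    from D tr [OF u v s(1,2) D(1)] tr [OF v w s(2,3) D(2)] tr [OF u w s(1,3) D(3)]
    have "\<forall>\<^sub>F n in sequentially. d x (g x) \<le> 2 * D + 4 * \<delta>"
    proof eventually_elim
      case (elim n)
      show ?case
        using dist_le_if_three_gromov_products_le [OF x maps [OF g x] gromov_sequencesD [OF u]
          gromov_sequencesD [OF v] gromov_sequencesD [OF w] elim] by linarith
    qed
    then show ?thesis by simp
  qed
  then show ?thesis
    by (intro finite_subset [OF _ discrete [OF x, of "2 * D + 4 * \<delta>"]]) blast
qed

text \<open>The powers of a nontrivial element would be infinitely many members of a finite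
  stabilizer.\<close>

lemma stabilizes_triple_imp_one:
  assumes "g \<in> carrier G" "stabilizes g u" "stabilizes g v" "stabilizes g w"
    and "u \<in> gromov_sequences M d" "v \<in> gromov_sequences M d" "w \<in> gromov_sequences M d"
    and "\<not> gromov_asymptotic M d u v" "\<not> gromov_asymptotic M d v w" "\<not> gromov_asymptotic M d u w"
  shows "g = \<one>"
proof (rule ccontr)
  assume "g \<noteq> \<one>"
  then have "infinite (range (\<lambda>n::nat. g [^] n))"
    using assms by (intro range_inj_infinite inj_pow)
  moreover have "range (\<lambda>n::nat. g [^] n) \<subseteq> {g \<in> carrier G. stabilizes g u \<and> stabilizes g v \<and> stabilizes g w}"
    using assms stabilizes_pow by auto
  ultimately show False
    using finite_stabilizer_of_triple [OF assms(5-)] infinite_super by blast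
qed

text \<open>
  A subgroup that fixes two boundary points moves \<open>x\<close> along a quasi-line joining them, so infinitely
  many of its elements \<open>s\<close> move \<open>x\<close> towards the limit of \<open>u\<close>. As \<open>h\<close> fixes that limit, the conjugates of \<open>h\<close>
  by these \<open>s\<close> have bounded displacement at \<open>x\<close>, hence two of them coincide.
\<close>
lemma stabilizer_meets_centralizer:
  assumes u: "u \<in> gromov_sequences M d" and v: "v \<in> gromov_sequences M d"
    and uv: "\<not> gromov_asymptotic M d u v"
    and g: "g \<in> carrier G" "g \<noteq> \<one>" "stabilizes g u" "stabilizes g v"
    and h: "h \<in> carrier G" "stabilizes h u"
  obtains t where "t \<in> carrier G" "t \<noteq> \<one>" "stabilizes t u" "stabilizes t v" "t \<otimes> h = h \<otimes> t"
proof -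
  define x where "x = u 0"
  have x: "x \<in> M" by (simp add: x_def gromov_sequencesD u)
  define T where "T = {s \<in> carrier G. stabilizes s u \<and> stabilizes s v}"
  have T_inv: "inv s \<in> T" if "s \<in> T" for s
    using that stabilizes_inv u v by (simp add: T_def)
  have "range (\<lambda>n::nat. g [^] n) \<subseteq> T"
    using g stabilizes_pow u v by (auto simp: T_def)
  moreover have "infinite (range (\<lambda>n::nat. g [^] n))"
    using g by (intro range_inj_infinite inj_pow)
  ultimately have T: "infinite T"
    by (rule infinite_super)
  obtain D0 where D0: "\<forall>\<^sub>F n in sequentially. gromov_product d x (u n) (v n) \<le> D0"
    using gromov_product_bounded_if_not_asymptotic [OF u v uv x] unfolding eventually_sequentially by blast
  \<comment> \<open>Two \<open>\<delta>\<close> come from translating the bound by \<open>s\<close>,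
    one from splitting it at \<open>x\<close>, and one from passing from frequently to
    eventually.\<close>
  define D where "D = D0 + 4 * \<delta>"
  \<comment> \<open>\<open>near s w\<close> says that \<open>s x\<close> lies near a geodesic from
    \<open>x\<close> to the limit of \<open>w\<close>, so that \<open>s\<close> moves
    \<open>x\<close> towards this limit.\<close>
  define near where "near s w \<longleftrightarrow> (\<forall>\<^sub>F n in sequentially. gromov_product d (s x) x (w n) \<le> D)"
    for s :: "'a \<Rightarrow> 'a" and w :: "nat \<Rightarrow> 'a"
  have near_cases: "near s u \<or> near s v" if s: "s \<in> T" for s
  proof -
    have sx: "s x \<in> M" using s x maps by (simp add: T_def)
    have "\<forall>\<^sub>F n in sequentially. gromov_product d (s x) (u n) (v n) \<le> D0 + 2 * \<delta>"
      using s by (intro eventually_translated_product_le x u v D0) (auto simp: T_def)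
    then have ev: "\<forall>\<^sub>F n in sequentially. gromov_product d (s x) x (u n) \<le> D0 + 3 * \<delta> \<or>
        gromov_product d (s x) x (v n) \<le> D0 + 3 * \<delta>"
    proof eventually_elim
      case (elim n)
      then show ?case
        using gromov_product_hyperbolic [OF sx gromov_sequencesD [OF u] x gromov_sequencesD [OF v], of n n]
          gromov_product_commute [of "s x" "u n" x] by linarith
    qed
    show ?thesis
    proof (cases "\<exists>\<^sub>F n in sequentially. gromov_product d (s x) x (u n) \<le> D0 + 3 * \<delta>")
      case True
      from gromov_product_frequently_imp_eventually [OF u sx x this] show ?thesis
        by (simp add: near_def D_def algebra_simps)
    next
      case False
      then have "\<forall>\<^sub>F n in sequentially. \<not> gromov_product d (s x) x (u n) \<le> D0 + 3 * \<delta>"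
        by (simp add: frequently_def)
      with ev have "\<forall>\<^sub>F n in sequentially. gromov_product d (s x) x (v n) \<le> D"
        by eventually_elim (use delta_nonneg [OF x] in \<open>auto simp: D_def\<close>)
      then show ?thesis by (simp add: near_def)
    qed
  qed
  \<comment> \<open>Applying \<open>s\<close> to the bound for \<open>inv s\<close> bounds the
    product of \<open>s x\<close> and \<open>v n\<close> at \<open>x\<close>. Its sum with the
    product of \<open>x\<close> and \<open>v n\<close> at \<open>s x\<close> is
    \<open>d x (s x)\<close>.\<close>
  have not_both: "d x (s x) \<le> 2 * D + \<delta>" if s: "s \<in> T" and n: "near s v" "near (inv s) v" for s
  proof -
    have sc: "s \<in> carrier G" "stabilizes s v" using s by (auto simp: T_def)
    have sx: "s x \<in> M" "(inv s) x \<in> M" using sc x maps by simp_all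
    have "s ((inv s) x) = x"
      using inv_apply [of "inv s" x] sc x by simp
    then have "gromov_product d x (s x) ((s \<circ> v) n) = gromov_product d ((inv s) x) x (v n)" for n
      using gromov_product_apply [OF sc(1) sx(2) x gromov_sequencesD [OF v, of n]] by simp
    then have "\<forall>\<^sub>F n in sequentially. gromov_product d x (s x) ((s \<circ> v) n) \<le> D"
      using n(2) by (simp add: near_def)
    then have "\<forall>\<^sub>F n in sequentially. gromov_product d x (s x) (v n) \<le> D + \<delta>"
      by (rule eventually_gromov_product_asymptotic [OF sc(2) [unfolded stabilizes_def]
          range_apply [OF sc(1) v] gromov_sequences_range [OF v] x sx(1)])
    with n(1) [unfolded near_def] have "\<forall>\<^sub>F n in sequentially. d x (s x) \<le> 2 * D + \<delta>"
    proof eventually_elim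
      case (elim n)
      then show ?case
        using gromov_product_sum_bases [of x "s x" "v n"] by linarith
    qed
    then show ?thesis by simp
  qed
  define S where "S = {s \<in> T. near s u}"
  \<comment> \<open>Up to finitely many elements, \<open>s\<close> or its inverse moves
    \<open>x\<close> towards the limit of \<open>u\<close>. Hence \<open>S\<close> inherits the
    infinitude of \<open>T\<close>.\<close>
  have "T \<subseteq> S \<union> (\<lambda>s. inv s) ` S \<union> {s \<in> carrier G. d x (s x) \<le> 2 * D + \<delta>}"
  proof
    fix s assume s: "s \<in> T"
    have "s = inv (inv s)" using s by (simp add: T_def)
    then show "s \<in> S \<union> (\<lambda>s. inv s) ` S \<union> {s \<in> carrier G. d x (s x) \<le> 2 * D + \<delta>}"
      using near_cases [OF s] near_cases [OF T_inv [OF s]] not_both [OF s] T_inv [OF s] s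
      unfolding S_def T_def by blast
  qed
  with T discrete [OF x, of "2 * D + \<delta>"] have S: "infinite S"
    by (meson finite_Un finite_imageI finite_subset)
  define C where "C = 2 * D + 3 * d x (h x) + 4 * \<delta>"
  have "d x ((inv s \<otimes> h \<otimes> s) x) \<le> C" if s: "s \<in> S" for s
  proof -
    have sc: "s \<in> carrier G" using s by (auto simp: S_def T_def)
    have sx: "s x \<in> M" "h (s x) \<in> M" using sc x h maps by simp_all
    have "d x ((inv s \<otimes> h \<otimes> s) x) = d ((inv s) (s x)) ((inv s) (h (s x)))"
      using sc h x sx by (simp add: mult_apply inv_apply)
    also have "\<dots> = d (s x) (h (s x))"
      using sc sx by (simp add: isometric)
    also have "\<dots> \<le> C"
      unfolding C_def using s maps [OF h(1)] isometric [OF h(1)] sx h x u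
      by (intro displacement_bound [where u = u and y = x]) (auto simp: S_def near_def stabilizes_def)
    finally show ?thesis .
  qed
  then have "(\<lambda>s. inv s \<otimes> h \<otimes> s) ` S \<subseteq> {g \<in> carrier G. d x (g x) \<le> C}"
    using h by (auto simp: S_def T_def)
  then have "finite ((\<lambda>s. inv s \<otimes> h \<otimes> s) ` S)"
    using discrete [OF x] finite_subset by blast
  then have "\<not> inj_on (\<lambda>s. inv s \<otimes> h \<otimes> s) S"
    using S finite_imageD by blast
  then obtain s s' where ss: "s \<in> S" "s' \<in> S" "s \<noteq> s'" "inv s \<otimes> h \<otimes> s = inv s' \<otimes> h \<otimes> s'"
    unfolding inj_on_def by blast
  then have c: "s \<in> carrier G" "s' \<in> carrier G" by (auto simp: S_def T_def)
  let ?t = "s \<otimes> inv s'"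
  have "h \<otimes> ?t = s \<otimes> (inv s \<otimes> h \<otimes> s) \<otimes> inv s'"
    using c h by (simp add: m_assoc [symmetric])
  also have "\<dots> = ?t \<otimes> h"
    unfolding ss(4) using c h by (simp add: m_assoc)
  finally have "?t \<otimes> h = h \<otimes> ?t" ..
  moreover have "?t \<noteq> \<one>"
    using c ss(3) by (metis inv_equality inv_inv inv_closed)
  moreover have "stabilizes ?t u" "stabilizes ?t v"
    using ss(1,2) u v stabilizes_mult stabilizes_inv by (auto simp: S_def T_def)
  ultimately show ?thesis
    using that [of ?t] c by simp
qed

text \<open>An element commuting with \<open>g\<close> permutes the fixed points of \<open>g\<close>
  at infinity.\<close>

lemma stabilizes_apply_commuting:
  assumes c: "c \<in> carrier G" and g: "g \<in> carrier G" and cg: "c \<otimes> g = g \<otimes> c"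
    and u: "u \<in> gromov_sequences M d" and s: "stabilizes g u"
  shows "stabilizes g (c \<circ> u)"
proof -
  have "g \<circ> (c \<circ> u) = c \<circ> (g \<circ> u)"
    using mult_apply [OF c g] mult_apply [OF g c] cg gromov_sequencesD [OF u] by fastforce
  moreover have "gromov_asymptotic M d (c \<circ> (g \<circ> u)) (c \<circ> u)"
    using s c g u range_apply gromov_sequences_range by (intro asymptotic_apply) (auto simp: stabilizes_def)
  ultimately show ?thesis by (simp add: stabilizes_def)
qed

lemma asymptotic_apply_cancel:
  assumes g: "g \<in> carrier G" and u: "u \<in> gromov_sequences M d" and v: "v \<in> gromov_sequences M d"
    and gg: "gromov_asymptotic M d (g \<circ> u) (g \<circ> v)"
  shows "gromov_asymptotic M d u v"
proof -
  have "inv g \<circ> (g \<circ> u) = u" "inv g \<circ> (g \<circ> v) = v"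
    using g gromov_sequencesD u v by (auto simp: inv_apply)
  then show ?thesis
    using asymptotic_apply [of "inv g", OF _ gg] g range_apply u v by (metis inv_closed)
qed

section \<open>Fixed points of powers at infinity\<close>

lemma ends_common_power:
  assumes g: "g \<in> carrier G" and u: "u \<in> ends g" and v: "v \<in> ends g"
  obtains k :: nat where "0 < k" "stabilizes (g [^] k) u" "stabilizes (g [^] k) v"
proof -
  obtain k l :: nat where k: "0 < k" "stabilizes (g [^] k) u" and l: "0 < l" "stabilizes (g [^] l) v"
    using u v unfolding ends_def by blast
  have "stabilizes ((g [^] k) [^] l) u" "stabilizes ((g [^] l) [^] k) v"
    using k l g u v stabilizes_pow endsD by auto
  then show ?thesis
    using k l g that [of "k * l"] by (simp add: nat_pow_pow mult.commute)
qed

text \<open>A common power would fix three distinct boundary points, hence be trivial, against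
  torsion-freeness.\<close>

lemma ends_triple:
  assumes g: "g \<in> carrier G" "g \<noteq> \<one>" and uvw: "u \<in> ends g" "v \<in> ends g" "w \<in> ends g"
  shows "gromov_asymptotic M d u v \<or> gromov_asymptotic M d v w \<or> gromov_asymptotic M d u w"
proof (rule ccontr)
  assume neg: "\<not> ?thesis"
  obtain k :: nat where k: "0 < k" "stabilizes (g [^] k) u" "stabilizes (g [^] k) v"
    using ends_common_power g uvw by metis
  obtain l :: nat where l: "0 < l" "stabilizes (g [^] l) w"
    using uvw unfolding ends_def by blast
  have "stabilizes ((g [^] k) [^] l) u" "stabilizes ((g [^] k) [^] l) v" "stabilizes ((g [^] l) [^] k) w"
    using k l g uvw stabilizes_pow endsD by auto
  then have "g [^] (k * l) = \<one>"
    using neg g uvw endsD by (intro stabilizes_triple_imp_one [of _ u v w]) (auto simp: nat_pow_pow mult.commute)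
  then show False
    using pow_neq_one g k l by simp
qed

text \<open>Let \<open>v\<close> be a second fixed point of a power of \<open>g\<close>. A
  nontrivial \<open>t\<close> fixing the limits of \<open>u\<close> and \<open>v\<close> commutes
  with a power of \<open>h\<close> that fixes the limit of \<open>u\<close>. This power sends the
  limit of \<open>v\<close> to a fixed point of \<open>t\<close>, of which there are at most two;
  the limit of \<open>u\<close> is excluded by injectivity, so the limit of \<open>v\<close> is
  fixed.\<close>

lemma ends_subset:
  assumes g: "g \<in> carrier G" "g \<noteq> \<one>" and h: "h \<in> carrier G" and u: "u \<in> ends g" "u \<in> ends h"
  shows "ends g \<subseteq> ends h"
proof
  fix v assume v: "v \<in> ends g"
  note GS = endsD [OF u(1)] endsD [OF v]
  show "v \<in> ends h"
  proof (cases "gromov_asymptotic M d u v")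
    case True
    then show ?thesis using ends_cong h u(2) GS by blast
  next
    case False
    obtain k :: nat where k: "0 < k" "stabilizes (g [^] k) u" "stabilizes (g [^] k) v"
      using ends_common_power g u v by metis
    obtain l :: nat where l: "0 < l" "stabilizes (h [^] l) u"
      using u(2) unfolding ends_def by blast
    let ?h = "h [^] l"
    have hc: "?h \<in> carrier G" using h by simp
    obtain t where t: "t \<in> carrier G" "t \<noteq> \<one>" "stabilizes t u" "stabilizes t v" "t \<otimes> ?h = ?h \<otimes> t"
      using stabilizer_meets_centralizer [OF GS False _ _ k(2,3) hc l(2)] pow_neq_one g k(1) by auto
    have hv: "stabilizes t (?h \<circ> v)" "?h \<circ> v \<in> gromov_sequences M d"
      using stabilizes_apply_commuting t hc GS gromov_sequences_apply by auto
    have "\<not> gromov_asymptotic M d u (?h \<circ> v)"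
    proof
      assume "gromov_asymptotic M d u (?h \<circ> v)"
      then have "gromov_asymptotic M d (?h \<circ> u) (?h \<circ> v)"
        using asymptotic_trans [OF l(2) [unfolded stabilizes_def]] gromov_sequences_apply hc GS by blast
      then show False
        using asymptotic_apply_cancel hc GS False by blast
    qed
    then have "gromov_asymptotic M d v (?h \<circ> v)"
      using stabilizes_triple_imp_one [OF t(1,3,4) hv(1) GS hv(2) False] t(2) by blast
    then have "stabilizes ?h v"
      by (simp add: stabilizes_def gromov_asymptotic_sym)
    then show ?thesis
      using l(1) GS by (auto simp: ends_def)
  qed
qed

text \<open>\<open>g\<close> permutes the at most two boundary points represented in
  \<open>ends g\<close>, so its square fixes each of them.\<close>

lemma stabilizes_square:
  assumes g: "g \<in> carrier G" "g \<noteq> \<one>" and u: "u \<in> ends g"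
  shows "stabilizes (g \<otimes> g) u"
proof -
  note GS = endsD [OF u]
  obtain k :: nat where k: "0 < k" "stabilizes (g [^] k) u"
    using u unfolding ends_def by blast
  have comm: "g \<otimes> g [^] k = g [^] k \<otimes> g" using g by (simp add: nat_pow_comm [of g 1 k, simplified])
  have gu: "g \<circ> u \<in> gromov_sequences M d" "g \<circ> (g \<circ> u) \<in> gromov_sequences M d"
    using g GS gromov_sequences_apply by auto
  have "stabilizes (g [^] k) (g \<circ> u)"
    using stabilizes_apply_commuting g comm GS k by auto
  moreover from this have "stabilizes (g [^] k) (g \<circ> (g \<circ> u))"
    using stabilizes_apply_commuting g comm gu by auto
  ultimately have ends: "g \<circ> u \<in> ends g" "g \<circ> (g \<circ> u) \<in> ends g"
    using gu k(1) unfolding ends_def by blast+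
  have gg: "(g \<otimes> g) \<circ> u = g \<circ> (g \<circ> u)"
    using gromov_sequencesD [OF GS] g by (auto simp: mult_apply)
  consider "gromov_asymptotic M d u (g \<circ> u)" | "gromov_asymptotic M d u (g \<circ> (g \<circ> u))"
    using ends_triple [OF g u ends] asymptotic_apply_cancel [OF g(1) GS gu(1)] by blast
  then show ?thesis
  proof cases
    case 1
    then have "stabilizes g u" by (simp add: stabilizes_def gromov_asymptotic_sym)
    then show ?thesis using stabilizes_mult g GS by blast
  next
    case 2
    then show ?thesis by (simp add: stabilizes_def gg gromov_asymptotic_sym)
  qed
qed

end

section \<open>Compactness in packed geodesic spaces\<close>

locale geodesic_metric_space = Metric_space M d for M :: "'a set" and d +
  assumes ex_geodesic: "x \<in> M \<Longrightarrow> y \<in> M \<Longrightarrow> \<exists>\<gamma>. \<gamma> \<in> {0..1} \<rightarrow> M \<and> \<gamma> 0 = x \<and> \<gamma> 1 = y \<and>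
    (\<forall>s\<in>{0..1}. \<forall>t\<in>{0..1::real}. d (\<gamma> s) (\<gamma> t) = \<bar>s - t\<bar> * d x y)"
begin

lemma point_at_distance:
  assumes "x \<in> M" "y \<in> M" "0 \<le> r" "r \<le> d x y"
  shows "\<exists>p\<in>M. d x p = r \<and> d p y = d x y - r"
proof (cases "d x y = 0")
  case True
  then show ?thesis using assms by auto
next
  case False
  with nonneg [of x y] have pos: "0 < d x y" by linarith
  obtain \<gamma> where \<gamma>: "\<gamma> \<in> {0..1} \<rightarrow> M" "\<gamma> 0 = x" "\<gamma> 1 = y"
    "\<And>s t. s \<in> {0..1} \<Longrightarrow> t \<in> {0..1::real} \<Longrightarrow> d (\<gamma> s) (\<gamma> t) = \<bar>s - t\<bar> * d x y"
    using ex_geodesic [OF assms(1,2)] by blast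
  define t where "t = r / d x y"
  have t: "t \<in> {0..1}" "t * d x y = r"
    using assms pos by (auto simp: t_def)
  then have "d x (\<gamma> t) = r" "d (\<gamma> t) y = d x y - r"
    using \<gamma>(4) [of 0 t] \<gamma>(4) [of t 1] \<gamma>(2,3) by (auto simp: algebra_simps)
  then show ?thesis using \<gamma>(1) t by blast
qed

text \<open>A separated set of maximal cardinality, which exists by the packing bound, covers the
  ball: an uncovered point could be added to it.\<close>

lemma packed_imp_finite_cover_of_small_ball:
  assumes "packed M d P0 r0" "0 < r0" "x \<in> M"
  shows "\<exists>S\<subseteq>M. finite S \<and> mcball x (3 * r0) \<subseteq> (\<Union>c\<in>S. mcball c (2 * r0))"
proof -
  define P where "P S \<longleftrightarrow> S \<subseteq> mcball x (3 * r0) \<and> pairwise (\<lambda>y z. d y z > 2 * r0) S" for S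
  have P: "finite S \<and> real (card S) \<le> P0" if "P S" for S
    using assms that unfolding packed_def P_def by blast
  have "\<forall>S. P S \<longrightarrow> card S < Suc (nat \<lfloor>P0\<rfloor>)"
    using P by (simp add: le_nat_floor less_Suc_eq_le)
  moreover have "P {}" by (simp add: P_def)
  ultimately have "\<exists>S. P S \<and> (\<forall>T. P T \<longrightarrow> card T \<le> card S)"
    by (rule ex_has_greatest_nat [rotated])
  then obtain S where S: "P S" "\<And>T. P T \<Longrightarrow> card T \<le> card S"
    by blast
  have "\<exists>c\<in>S. p \<in> mcball c (2 * r0)" if p: "p \<in> mcball x (3 * r0)" for p
  proof (rule ccontr)
    assume neg: "\<not> ?thesis"
    have "S \<subseteq> M" "p \<in> M" using S(1) p by (auto simp: P_def)
    then have far: "d c p > 2 * r0" if "c \<in> S" for c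
      using neg that by (auto simp: in_mcball)
    then have "P (insert p S)"
      using S(1) p by (auto simp: P_def pairwise_insert commute)
    moreover have "p \<notin> S"
      using far [of p] \<open>p \<in> M\<close> \<open>0 < r0\<close> by auto
    ultimately show False
      using S P by (metis card_insert_disjoint not_less_eq_eq order_refl)
  qed
  then show ?thesis
    using S(1) P by (intro exI [of _ S]) (auto simp: P_def)
qed

text \<open>Enlarging the radius by \<open>r0\<close> keeps every point within \<open>3 * r0\<close>
  of an old centre, because geodesics lead back into the smaller ball. The small balls around the
  old centres are then covered again.\<close>

lemma packed_imp_finite_cover:
  assumes pk: "packed M d P0 r0" "0 < r0" and x: "x \<in> M"
  shows "\<exists>S\<subseteq>M. finite S \<and> mcball x R \<subseteq> (\<Union>c\<in>S. mcball c (2 * r0))"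
proof -
  have *: "\<exists>S\<subseteq>M. finite S \<and> mcball x (real n * r0) \<subseteq> (\<Union>c\<in>S. mcball c (2 * r0))" for n
  proof (induction n)
    case 0
    have "mcball x 0 \<subseteq> mcball x (2 * r0)"
      using \<open>0 < r0\<close> by (intro mcball_subset_concentric) simp
    then show ?case using x by (intro exI [of _ "{x}"]) simp
  next
    case (Suc n)
    then obtain S where S: "S \<subseteq> M" "finite S" "mcball x (real n * r0) \<subseteq> (\<Union>c\<in>S. mcball c (2 * r0))"
      by blast
    have "\<forall>c\<in>S. \<exists>T\<subseteq>M. finite T \<and> mcball c (3 * r0) \<subseteq> (\<Union>c\<in>T. mcball c (2 * r0))"
      using packed_imp_finite_cover_of_small_ball [OF pk] S(1) by blast
    then obtain T where T: "\<And>c. c \<in> S \<Longrightarrow> T c \<subseteq> M \<and> finite (T c) \<and>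
        mcball c (3 * r0) \<subseteq> (\<Union>c\<in>T c. mcball c (2 * r0))"
      by metis
    have "p \<in> (\<Union>c\<in>(\<Union>c\<in>S. T c). mcball c (2 * r0))" if p: "p \<in> mcball x (real (Suc n) * r0)" for p
    proof -
      have pM: "p \<in> M" "d x p \<le> real n * r0 + r0"
        using p by (auto simp: in_mcball algebra_simps)
      obtain q where q: "q \<in> M" "d x q \<le> real n * r0" "d q p \<le> r0"
      proof (cases "d x p \<le> real n * r0")
        case True
        then show ?thesis using that [of p] pM \<open>0 < r0\<close> by simp
      next
        case False
        then obtain q where "q \<in> M" "d x q = real n * r0" "d q p = d x p - real n * r0"
          using point_at_distance [OF x pM(1), of "real n * r0"] \<open>0 < r0\<close> by auto
        then show ?thesis using that [of q] pM by simp
      qed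
      then obtain c where c: "c \<in> S" "q \<in> mcball c (2 * r0)"
        using S(3) x by (auto simp: in_mcball subset_iff)
      then have "p \<in> mcball c (3 * r0)"
        using triangle [of c q p] q pM by (auto simp: in_mcball)
      then show ?thesis using T [OF c(1)] c(1) by blast
    qed
    moreover have "(\<Union>c\<in>S. T c) \<subseteq> M" "finite (\<Union>c\<in>S. T c)"
      using T S(2) by auto
    ultimately show ?case by blast
  qed
  obtain n where "R / r0 \<le> real n" using real_arch_simple by blast
  then have "mcball x R \<subseteq> mcball x (real n * r0)"
    using \<open>0 < r0\<close> by (intro mcball_subset_concentric) (simp add: field_simps)
  with * [of n] show ?thesis by blast
qed

text \<open>
  Points in the same ball of radius \<open>2 r\<^sub>0\<close> of the cover, at distance \<open>R\<close> from \<open>x\<close> on geodesics from \<open>x\<close>,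
  force the Gromov product of the endpoints to be at least \<open>R - 2 r\<^sub>0\<close>. A diagonal argument over \<open>R\<close>
  then replaces the theorem of Arzela and Ascoli.
\<close>
lemma ex_gromov_subsequence:
  fixes y :: "nat \<Rightarrow> 'a"
  assumes pk: "packed M d P0 r0" "0 < r0" and x: "x \<in> M" and y: "range y \<subseteq> M"
    and unbounded: "\<And>R. finite {n. d x (y n) \<le> R}"
  shows "\<exists>r. strict_mono r \<and> y \<circ> r \<in> gromov_sequences M d"
proof -
  define P where "P k s \<longleftrightarrow> (\<forall>i j. real k - 2 * r0 \<le> gromov_product d x (y (s i)) (y (s j)))"
    for k and s :: "nat \<Rightarrow> nat"
  have "\<exists>r. strict_mono r \<and> P k (s \<circ> r)" if s: "strict_mono s" for k and s :: "nat \<Rightarrow> nat"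
  proof -
    obtain S where S: "S \<subseteq> M" "finite S" "mcball x (real k) \<subseteq> (\<Union>c\<in>S. mcball c (2 * r0))"
      using packed_imp_finite_cover [OF pk x, of "real k"] by (elim exE conjE)
    define A where "A = {i. real k < d x (y (s i))}"
    have "finite (s -` {n. d x (y n) \<le> real k})"
      using s unbounded by (intro finite_vimageI strict_mono_imp_inj_on)
    moreover have "- A = s -` {n. d x (y n) \<le> real k}"
      by (auto simp: A_def)
    ultimately have A: "infinite A"
      by (metis finite_Un Compl_partition infinite_UNIV_nat)
    define near where "near i c \<longleftrightarrow>
      (\<exists>p\<in>M. d x p = real k \<and> d p (y (s i)) = d x (y (s i)) - real k \<and> d c p \<le> 2 * r0)" for i c
    have "\<exists>c\<in>S. near i c" if i: "i \<in> A" for i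
    proof -
      have "y (s i) \<in> M" using y by auto
      then obtain p where p: "p \<in> M" "d x p = real k" "d p (y (s i)) = d x (y (s i)) - real k"
        using point_at_distance [OF x, of "y (s i)" "real k"] i by (auto simp: A_def)
      then have "p \<in> mcball x (real k)" using x by (simp add: in_mcball)
      with S(3) obtain c where "c \<in> S" "p \<in> mcball c (2 * r0)" by blast
      then show ?thesis using p by (auto simp: near_def in_mcball)
    qed
    then obtain c where c: "c \<in> S" "infinite {i \<in> A. near i c}"
      using pigeonhole_infinite_rel [OF A S(2)] by blast
    define r where "r = enumerate {i \<in> A. near i c}"
    have r: "strict_mono r" "\<And>i. near (r i) c"
      using c(2) enumerate_in_set [OF c(2)] by (auto simp: r_def strict_mono_enumerate)
    have "real k - 2 * r0 \<le> gromov_product d x (y (s i)) (y (s j))" if ij: "near i c" "near j c" for i j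
    proof -
      obtain p q where p: "p \<in> M" "d p (y (s i)) = d x (y (s i)) - real k" "d c p \<le> 2 * r0"
        and q: "q \<in> M" "d q (y (s j)) = d x (y (s j)) - real k" "d c q \<le> 2 * r0"
        using ij unfolding near_def by blast
      have M: "y (s i) \<in> M" "y (s j) \<in> M" "c \<in> M" using y c S(1) by auto
      have "d (y (s i)) (y (s j)) \<le> d (y (s i)) p + d p c + d c q + d q (y (s j))"
        using triangle [OF M(1) p(1) M(2)] triangle [OF p(1) M(3,2)] triangle [OF M(3) q(1) M(2)] by linarith
      then show ?thesis
        using p q commute [of p "y (s i)"] commute [of c p]
        unfolding gromov_product_def add_divide_distrib diff_divide_distrib by linarith
    qed
    with r show ?thesis by (auto simp: P_def)
  qed
  then interpret subseqs P by unfold_locales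
  \<comment> \<open>\<open>P k\<close> passes to subsequences, and the diagonal sequence is a
    subsequence of the \<open>k\<close>-th selection only after its first \<open>Suc k\<close> terms
    are dropped.\<close>
  have P: "P k (diagseq \<circ> (+) (Suc k))" for k
    by (rule diagseq_holds) (simp add: P_def)
  have "gromov_asymptotic M d (y \<circ> diagseq) (y \<circ> diagseq)"
  proof (rule gromov_asymptoticI [OF x])
    fix B
    obtain k where k: "B + 2 * r0 \<le> real k" using real_arch_simple by blast
    have "B \<le> gromov_product d x ((y \<circ> diagseq) m) ((y \<circ> diagseq) n)" if "m \<ge> Suc k" "n \<ge> Suc k" for m n
    proof -
      have "real k - 2 * r0 \<le> gromov_product d x (y (diagseq (Suc k + (m - Suc k)))) (y (diagseq (Suc k + (n - Suc k))))"
        using P [of k] unfolding P_def by simp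
      then show ?thesis using k that by simp
    qed
    then show "\<exists>N. \<forall>m\<ge>N. \<forall>n\<ge>N. B \<le> gromov_product d x ((y \<circ> diagseq) m) ((y \<circ> diagseq) n)"
      by blast
  qed (use y in auto)
  then have "y \<circ> diagseq \<in> gromov_sequences M d"
    using y by (auto simp: gromov_sequences_def)
  then show ?thesis using subseq_diagseq by blast
qed

end

section \<open>Virtually nilpotent groups\<close>

lemma (in group) lower_central_series_incl: "lower_central_series G n \<subseteq> carrier G"
proof (induction n)
  case (Suc n)
  then show ?case by (auto intro!: generate_incl)
qed simp

lemma (in group) one_in_lower_central_series: "\<one> \<in> lower_central_series G n"
  by (cases n) (auto intro: generate.one)

text \<open>The last nontrivial term of the lower central series is central.\<close>

lemma (in group) nilpotent_nontrivial_center: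
  assumes "nilpotent_group G" and "carrier G \<noteq> {\<one>}"
  obtains z where "z \<in> carrier G" "z \<noteq> \<one>" "\<And>x. x \<in> carrier G \<Longrightarrow> x \<otimes> z = z \<otimes> x"
proof -
  define n where "n = (LEAST n. lower_central_series G n = {\<one>})"
  have n: "lower_central_series G n = {\<one>}"
    unfolding n_def using assms(1) unfolding nilpotent_group_def by (rule LeastI_ex)
  with assms(2) obtain m where m: "n = Suc m" by (cases n) auto
  then have "lower_central_series G m \<noteq> {\<one>}"
    using not_less_Least [of m "\<lambda>n. lower_central_series G n = {\<one>}"] by (auto simp: n_def)
  then obtain z where z: "z \<in> lower_central_series G m" "z \<noteq> \<one>"
    using one_in_lower_central_series [of m] by blast
  then have zc: "z \<in> carrier G" using lower_central_series_incl by blast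
  have "x \<otimes> z = z \<otimes> x" if x: "x \<in> carrier G" for x
  proof -
    have "x \<otimes> z \<otimes> inv x \<otimes> inv z \<in> lower_central_series G (Suc m)"
      using x z(1) by (auto intro!: generate.incl)
    then have "x \<otimes> z \<otimes> inv x \<otimes> inv z = \<one>"
      using n m by simp
    then have "x \<otimes> z \<otimes> inv x = z"
      using x zc inv_equality [of "x \<otimes> z \<otimes> inv x" "inv z"] by simp
    moreover have "x \<otimes> z = x \<otimes> z \<otimes> inv x \<otimes> x"
      using x zc by (simp add: m_assoc)
    ultimately show ?thesis by simp
  qed
  with that z(2) zc show ?thesis by blast
qed

text \<open>Two powers of \<open>g\<close> lie in the same coset of \<open>H\<close>, so the power
  by the difference of the exponents lies in \<open>H\<close>.\<close>

lemma (in group) finite_index_power_mem: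
  assumes H: "subgroup H G" and fin: "finite (rcosets H)" and g: "g \<in> carrier G"
  shows "\<exists>k::nat. 0 < k \<and> g [^] k \<in> H"
proof -
  have "range (\<lambda>n::nat. H #> g [^] n) \<subseteq> rcosets H"
    using g by (auto simp: RCOSETS_def)
  then have "\<not> inj (\<lambda>n::nat. H #> g [^] n)"
    using fin finite_subset finite_imageD by blast
  then obtain i j :: nat where ij: "i < j" "H #> g [^] i = H #> g [^] j"
    unfolding inj_def by (metis linorder_neqE_nat)
  have "g [^] j \<in> H #> g [^] i"
    using ij(2) rcos_self [OF _ H] g by simp
  then obtain h where h: "h \<in> H" "g [^] j = h \<otimes> g [^] i"
    by (auto simp: r_coset_def)
  have "g [^] j = g [^] (j - i) \<otimes> g [^] i"
    using ij(1) g by (simp add: nat_pow_mult)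
  then have "g [^] (j - i) = h"
    using h g subgroup.mem_carrier [OF H] by simp
  then show ?thesis using h(1) ij(1) by (intro exI [of _ "j - i"]) simp
qed

text \<open>Suitable powers of \<open>g\<close> and \<open>h\<close> lie in a nilpotent subgroup of
  finite index. It is nontrivial because the power of \<open>g\<close> is, so it has a nontrivial
  central element.\<close>

lemma (in group) virtually_nilpotent_common_commuting:
  assumes vn: "virtually_nilpotent G" and tf: "torsion_free G"
    and g: "g \<in> carrier G" "g \<noteq> \<one>" and h: "h \<in> carrier G"
  obtains z and k l :: nat where "z \<in> carrier G" "z \<noteq> \<one>" "0 < k" "g [^] k \<otimes> z = z \<otimes> g [^] k"
    "0 < l" "h [^] l \<otimes> z = z \<otimes> h [^] l"
proof -
  obtain H where H: "subgroup H G" "finite (rcosets H)" "nilpotent_group (G\<lparr>carrier := H\<rparr>)"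
    using vn unfolding virtually_nilpotent_def by blast
  obtain k :: nat where k: "0 < k" "g [^] k \<in> H" using finite_index_power_mem H g by blast
  obtain l :: nat where l: "0 < l" "h [^] l \<in> H" using finite_index_power_mem H h by blast
  have "g [^] k \<noteq> \<one>" using tf g k(1) unfolding torsion_free_def by blast
  then have "carrier (G\<lparr>carrier := H\<rparr>) \<noteq> {\<one>\<^bsub>G\<lparr>carrier := H\<rparr>\<^esub>}" using k by auto
  then obtain z where "z \<in> H" "z \<noteq> \<one>" "\<And>x. x \<in> H \<Longrightarrow> x \<otimes> z = z \<otimes> x"
    using group.nilpotent_nontrivial_center [OF subgroup.subgroup_is_group [OF H(1) is_group] H(3)] by auto
  then show ?thesis
    using that [of z k l] k l subgroup.mem_carrier [OF H(1)] by blast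
qed

section \<open>Groups with short elements everywhere\<close>

locale packed_hyperbolic_isometry_group =
  hyperbolic_isometry_group M d \<delta> G + geodesic_metric_space M d
  for M :: "'a set" and d and \<delta> and G :: "('a \<Rightarrow> 'a, 'b) monoid_scheme" (structure) +
  fixes P0 r0 :: real
  assumes packed: "packed M d P0 r0" and r0_pos: "0 < r0"
begin

text \<open>The orbit of \<open>x\<close> under the powers of \<open>z\<close> leaves every ball and
  thus accumulates at infinity. An element \<open>c\<close> commuting with \<open>z\<close> moves
  all its points by the same distance \<open>d x (c x)\<close>.\<close>

lemma ex_end_of_centralizer:
  assumes z: "z \<in> carrier G" "z \<noteq> \<one>" and x: "x \<in> M"
  obtains u where "u \<in> gromov_sequences M d"
    "\<And>c. c \<in> carrier G \<Longrightarrow> c \<otimes> z = z \<otimes> c \<Longrightarrow> stabilizes c u"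
proof -
  define y where "y n = (z [^] n) x" for n :: nat
  have y: "range y \<subseteq> M" using maps z x by (auto simp: y_def)
  have "finite {n. d x (y n) \<le> R}" for R
  proof -
    have "finite ((\<lambda>n::nat. z [^] n) -` {g \<in> carrier G. d x (g x) \<le> R})"
      by (intro finite_vimageI discrete x inj_pow z)
    also have "(\<lambda>n::nat. z [^] n) -` {g \<in> carrier G. d x (g x) \<le> R} = {n. d x (y n) \<le> R}"
      using z by (auto simp: y_def)
    finally show ?thesis .
  qed
  then obtain r where r: "y \<circ> r \<in> gromov_sequences M d"
    using ex_gromov_subsequence [OF packed r0_pos x y] by blast
  have "stabilizes c (y \<circ> r)" if c: "c \<in> carrier G" "c \<otimes> z = z \<otimes> c" for c
  proof -
    have "d ((y \<circ> r) n) ((c \<circ> (y \<circ> r)) n) = d x (c x)" for n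
    proof -
      have zn: "z [^] r n \<in> carrier G" using z by simp
      have "c \<otimes> z [^] r n = z [^] r n \<otimes> c"
        using group_commutes_pow [of z c "r n"] c z by simp
      then have "c ((z [^] r n) x) = (z [^] r n) (c x)"
        using mult_apply [OF c(1) zn x] mult_apply [OF zn c(1) x] by simp
      then show ?thesis
        using isometric [OF zn x maps [OF c(1) x]] by (simp add: y_def)
    qed
    then have "gromov_asymptotic M d (y \<circ> r) (c \<circ> (y \<circ> r))"
      using range_apply [OF c(1) r] by (intro gromov_asymptotic_if_bounded [OF r]) auto
    then show ?thesis
      by (simp add: stabilizes_def gromov_asymptotic_sym)
  qed
  with that r show ?thesis by blast
qed

text \<open>A limit point of the orbit of \<open>z\<close> is fixed by both powers, so
  \<open>ends g\<close> and \<open>ends h\<close> meet.\<close>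

lemma ends_eq_if_commensurable_commuting:
  assumes g: "g \<in> carrier G" "g \<noteq> \<one>" and h: "h \<in> carrier G" "h \<noteq> \<one>"
    and z: "z \<in> carrier G" "z \<noteq> \<one>" and x: "x \<in> M"
    and k: "0 < (k::nat)" "g [^] k \<otimes> z = z \<otimes> g [^] k" and l: "0 < (l::nat)" "h [^] l \<otimes> z = z \<otimes> h [^] l"
  shows "ends g = ends h" "ends g \<noteq> {}"
proof -
  obtain u where u: "u \<in> gromov_sequences M d"
    "\<And>c. c \<in> carrier G \<Longrightarrow> c \<otimes> z = z \<otimes> c \<Longrightarrow> stabilizes c u"
    using ex_end_of_centralizer [OF z x] by blast
  have "u \<in> ends g" "u \<in> ends h"
    using u(2) [of "g [^] k"] u(2) [of "h [^] l"] u(1) g h k l unfolding ends_def by auto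
  then show "ends g = ends h" "ends g \<noteq> {}"
    using ends_subset g h by blast+
qed

text \<open>
  The sets of points with a given value of \<open>ends\<close> for their short elements are open and
  partition the connected space \<open>M\<close>.
\<close>
lemma ends_of_short_elements_const:
  assumes short: "\<And>x. x \<in> M \<Longrightarrow> \<exists>g\<in>carrier G. g \<noteq> \<one> \<and> d x (g x) < \<epsilon>"
    and same: "\<And>x g h. \<lbrakk>x \<in> M; g \<in> carrier G; g \<noteq> \<one>; h \<in> carrier G; h \<noteq> \<one>;
      d x (g x) < \<epsilon>; d x (h x) < \<epsilon>\<rbrakk> \<Longrightarrow> ends g = ends h"
    and x: "x \<in> M" "g \<in> carrier G" "g \<noteq> \<one>" "d x (g x) < \<epsilon>"
    and y: "y \<in> M" "h \<in> carrier G" "h \<noteq> \<one>" "d y (h y) < \<epsilon>"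
  shows "ends g = ends h"
proof -
  obtain \<gamma> where "\<gamma> \<in> {0..1} \<rightarrow> M" "\<gamma> 0 = x" "\<gamma> 1 = y"
    "\<forall>s\<in>{0..1}. \<forall>t\<in>{0..1::real}. d (\<gamma> s) (\<gamma> t) = \<bar>s - t\<bar> * d x y"
    using ex_geodesic [OF x(1) y(1)] by (elim exE conjE)
  note \<gamma> = this(1-3) this(4) [rule_format]
  have "\<forall>p\<in>M. \<exists>g. g \<in> carrier G \<and> g \<noteq> \<one> \<and> d p (g p) < \<epsilon>"
    using short by blast
  then obtain sh where sh: "\<And>p. p \<in> M \<Longrightarrow> sh p \<in> carrier G \<and> sh p \<noteq> \<one> \<and> d p (sh p p) < \<epsilon>"
    by metis
  \<comment> \<open>A geodesic reduces the claim to connectedness of the unit interval. By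
    \<open>same\<close>, the arbitrary choice made by \<open>sh\<close> does not affect the value of
    \<open>ends\<close>.\<close>
  have "ends (sh (\<gamma> 0)) = ends (sh (\<gamma> 1))"
  proof (rule connected_equivalence_relation [of "{0..1::real}"])
    fix s :: real assume s: "s \<in> {0..1}"
    then have p: "\<gamma> s \<in> M" using \<gamma>(1) by blast
    let ?g = "sh (\<gamma> s)"
    \<comment> \<open>The summand 1 keeps \<open>L\<close> positive when \<open>x = y\<close>.
      Moving along the geodesic for a time below \<open>e\<close> changes the displacement by less
      than \<open>2 * e * L\<close>, the gap left below \<open>\<epsilon>\<close>.\<close>
    define L where "L = d x y + 1"
    define e where "e = (\<epsilon> - d (\<gamma> s) (?g (\<gamma> s))) / (2 * L)"
    have L: "0 < L" "d x y \<le> L" using nonneg [of x y] unfolding L_def by linarith+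
    have e: "0 < e" "2 * e * L = \<epsilon> - d (\<gamma> s) (?g (\<gamma> s))"
      using sh [OF p] L by (simp_all add: e_def)
    have "ends ?g = ends (sh (\<gamma> t))" if t: "t \<in> {0..1} \<inter> ball s e" for t
    proof -
      have q: "\<gamma> t \<in> M" using \<gamma>(1) t by blast
      note gM = maps [OF conjunct1 [OF sh [OF p]]]
      have "\<bar>s - t\<bar> * d x y \<le> e * L"
        using t nonneg [of x y] L by (intro mult_mono) (auto simp: dist_real_def)
      moreover have "e * L < \<epsilon> - d (\<gamma> s) (?g (\<gamma> s)) - \<bar>s - t\<bar> * d x y"
      proof -
        have "\<bar>s - t\<bar> * d x y \<le> \<bar>s - t\<bar> * L" using L by (intro mult_left_mono) auto
        also have "\<dots> < e * L"
          using t L by (intro mult_strict_right_mono) (auto simp: dist_real_def)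
        finally show ?thesis using e(2) by linarith
      qed
      moreover have "d (\<gamma> t) (\<gamma> s) = \<bar>s - t\<bar> * d x y" "d (?g (\<gamma> s)) (?g (\<gamma> t)) = \<bar>s - t\<bar> * d x y"
        using \<gamma>(4) [of s t] s t isometric [OF conjunct1 [OF sh [OF p]] p q] commute [of "\<gamma> s" "\<gamma> t"] by auto
      ultimately have "d (\<gamma> t) (?g (\<gamma> t)) < \<epsilon>"
        using triangle [OF q p gM [OF q]] triangle [OF p gM [OF p] gM [OF q]] by linarith
      then show ?thesis
        using same [OF q, of ?g "sh (\<gamma> t)"] sh [OF p] sh [OF q] by blast
    qed
    moreover have "openin (top_of_set {0..1}) ({0..1} \<inter> ball s e)"
      by (rule openin_open_Int [OF open_ball])
    moreover have "s \<in> {0..1} \<inter> ball s e"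
      using s e(1) by simp
    ultimately show "\<exists>T. openin (top_of_set {0..1}) T \<and> s \<in> T \<and> (\<forall>t\<in>T. ends ?g = ends (sh (\<gamma> t)))"
      by blast
  qed auto
  then have "ends (sh x) = ends (sh y)" using \<gamma> by simp
  moreover have "ends g = ends (sh x)" "ends h = ends (sh y)"
    using same [OF x(1)] same [OF y(1)] sh [OF x(1)] sh [OF y(1)] x y by blast+
  ultimately show ?thesis by simp
qed

text \<open>
  At points tending to a boundary point \<open>v\<close>, squares of short elements fix a point \<open>u\<close> of the common
  value \<open>E\<close> of \<open>ends\<close>, so they have bounded displacement at a point near a geodesic from \<open>u\<close> to \<open>v\<close>.
  Hence infinitely many of them coincide, and this element also fixes \<open>v\<close>.
\<close>
lemma all_gromov_sequences_in_ends:
  assumes short: "\<And>x. x \<in> M \<Longrightarrow> \<exists>g\<in>carrier G. g \<noteq> \<one> \<and> d x (g x) < \<epsilon> \<and> ends g = E"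
    and u: "u \<in> E" and v: "v \<in> gromov_sequences M d"
  shows "v \<in> E"
proof -
  obtain x where x: "x \<in> M" using gromov_sequencesD [OF v] by blast
  have uG: "u \<in> gromov_sequences M d" using short [OF x] u endsD by blast
  have "\<forall>n. \<exists>g\<in>carrier G. g \<noteq> \<one> \<and> d (v n) (g (v n)) < \<epsilon> \<and> ends g = E"
    using short gromov_sequencesD [OF v] by blast
  then obtain g where g: "\<And>n. g n \<in> carrier G" "\<And>n. g n \<noteq> \<one>" "\<And>n. d (v n) (g n (v n)) < \<epsilon>" "\<And>n. ends (g n) = E"
    by metis
  show ?thesis
  proof (cases "gromov_asymptotic M d u v")
    case True
    then show ?thesis
      using ends_cong [OF g(1) _ v True] u g(4) by blast
  next
    case False
    \<comment> \<open>Squares fix the limit of \<open>u\<close> for every \<open>n\<close>, which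
      avoids exponents depending on \<open>n\<close> and keeps the displacement at
      \<open>v n\<close> below \<open>2 * \<epsilon>\<close>.\<close>
    define k where "k n = g n \<otimes> g n" for n
    have k: "k n \<in> carrier G" "stabilizes (k n) u" "d (v n) (k n (v n)) \<le> 2 * \<epsilon>" for n
    proof -
      show "k n \<in> carrier G" using g(1) by (simp add: k_def)
      show "stabilizes (k n) u" unfolding k_def using stabilizes_square g u by blast
      have vM: "v n \<in> M" "g n (v n) \<in> M" "g n (g n (v n)) \<in> M" using gromov_sequencesD [OF v] maps g(1) by auto
      have "d (g n (v n)) (g n (g n (v n))) = d (v n) (g n (v n))"
        using isometric [OF g(1) vM(1,2)] .
      then show "d (v n) (k n (v n)) \<le> 2 * \<epsilon>"
        using triangle [OF vM] g(3) [of n] mult_apply [OF g(1) g(1) vM(1), of n n] by (simp add: k_def)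
    qed
    obtain D N where D: "\<forall>m\<ge>N. \<forall>n\<ge>N. gromov_product d x (u m) (v n) \<le> D"
      using gromov_product_bounded_if_not_asymptotic [OF uG v False x] by blast
    define C where "C = 2 * D + 3 * (2 * \<epsilon>) + 4 * \<delta>"
    have "d x (k n x) \<le> C" if n: "n \<ge> N" for n
      unfolding C_def
    proof (rule displacement_bound [where u = u and y = "v n"])
      have "gromov_product d x (v n) (u m) \<le> D" if "m \<ge> N" for m
        using D n that by (subst gromov_product_commute) blast
      then show "\<forall>\<^sub>F m in sequentially. gromov_product d x (v n) (u m) \<le> D"
        unfolding eventually_sequentially by blast
      show "k n ` M \<subseteq> M" using maps [OF k(1)] by blast
      show "gromov_asymptotic M d (k n \<circ> u) u"
        using k(2) by (simp add: stabilizes_def)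
    qed (use k isometric x uG gromov_sequencesD [OF v] in auto)
    then have "k ` {N..} \<subseteq> {g \<in> carrier G. d x (g x) \<le> C}"
      using k(1) by auto
    then have "finite (k ` {N..})"
      using discrete [OF x] finite_subset by blast
    then obtain n0 where n0: "n0 \<in> {N..}" "infinite {n \<in> {N..}. k n = k n0}"
      using pigeonhole_infinite [of "{N..}" k] infinite_Ici by blast
    let ?k = "k n0"
    have kv: "?k \<circ> v \<in> gromov_sequences M d"
      using gromov_sequences_apply k(1) v by blast
    have "gromov_asymptotic M d (?k \<circ> v) v"
    proof (rule gromov_asymptoticI [OF x gromov_sequences_range [OF kv] gromov_sequences_range [OF v]])
      fix B
      obtain N1 where N1: "\<And>m n. m \<ge> N1 \<Longrightarrow> n \<ge> N1 \<Longrightarrow> B + 2 * \<epsilon> + \<delta> \<le> gromov_product d x (v m) (v n)"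
        using gromov_asymptoticE [OF gromov_sequences_asymptotic_refl [OF v] x] by metis
      obtain N2 where N2: "\<And>m n. m \<ge> N2 \<Longrightarrow> n \<ge> N2 \<Longrightarrow> B + \<delta> \<le> gromov_product d x ((?k \<circ> v) m) ((?k \<circ> v) n)"
        using gromov_asymptoticE [OF gromov_sequences_asymptotic_refl [OF kv] x] by metis
      \<comment> \<open>At this late index \<open>?k\<close> moves \<open>v p\<close> by at most
        \<open>2 * \<epsilon>\<close>. So \<open>?k (v p)\<close> links the late terms of
        \<open>?k \<circ> v\<close> to those of \<open>v\<close>.\<close>
      obtain p where p: "p \<ge> max N1 N2" "k p = ?k"
        using n0(2) unfolding infinite_nat_iff_unbounded_le by blast
      have "B \<le> gromov_product d x ((?k \<circ> v) m) (v n)" if mn: "m \<ge> max N1 N2" "n \<ge> max N1 N2" for m n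
      proof -
        have M: "(?k \<circ> v) m \<in> M" "(?k \<circ> v) p \<in> M" "v p \<in> M" "v n \<in> M"
          using gromov_sequencesD [OF kv] gromov_sequencesD [OF v] by blast+
        have "gromov_product d x (v p) (v n) \<le> gromov_product d x ((?k \<circ> v) p) (v n) + d (v p) ((?k \<circ> v) p)"
          by (rule gromov_product_left_change [OF x M(3,2,4)])
        moreover have "d (v p) ((?k \<circ> v) p) \<le> 2 * \<epsilon>"
          using k(3) [of p] p(2) by simp
        moreover have "B + 2 * \<epsilon> + \<delta> \<le> gromov_product d x (v p) (v n)"
          using N1 p(1) mn by simp
        moreover have "B + \<delta> \<le> gromov_product d x ((?k \<circ> v) m) ((?k \<circ> v) p)"
          using N2 [of m p] p(1) mn by simp
        ultimately show ?thesis
          using gromov_product_hyperbolic [OF x M(1,2,4)] by linarith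
      qed
      then show "\<exists>N. \<forall>m\<ge>N. \<forall>n\<ge>N. B \<le> gromov_product d x ((?k \<circ> v) m) (v n)" by blast
    qed
    then have "stabilizes (g n0 [^] (2::nat)) v"
      using g(1) by (simp add: stabilizes_def k_def numeral_2_eq_2)
    then have "v \<in> ends (g n0)"
      using v unfolding ends_def by (auto intro!: exI [of _ 2])
    then show ?thesis using g(4) by simp
  qed
qed

text \<open>\<open>comm\<close> is the form in which virtual nilpotency enters the geometric
  argument.\<close>

lemma boundary_at_most_two_points:
  assumes short: "\<And>x. x \<in> M \<Longrightarrow> \<exists>g\<in>carrier G. g \<noteq> \<one> \<and> d x (g x) < \<epsilon>"
    and comm: "\<And>x g h. \<lbrakk>x \<in> M; g \<in> carrier G; g \<noteq> \<one>; h \<in> carrier G; h \<noteq> \<one>;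
      d x (g x) < \<epsilon>; d x (h x) < \<epsilon>\<rbrakk> \<Longrightarrow> \<exists>z\<in>carrier G. z \<noteq> \<one> \<and>
        (\<exists>k>0::nat. g [^] k \<otimes> z = z \<otimes> g [^] k) \<and> (\<exists>l>0::nat. h [^] l \<otimes> z = z \<otimes> h [^] l)"
    and uvw: "u \<in> gromov_sequences M d" "v \<in> gromov_sequences M d" "w \<in> gromov_sequences M d"
  shows "gromov_asymptotic M d u v \<or> gromov_asymptotic M d v w \<or> gromov_asymptotic M d u w"
proof -
  obtain x where x: "x \<in> M" using gromov_sequencesD [OF uvw(1)] by blast
  obtain g where g: "g \<in> carrier G" "g \<noteq> \<one>" "d x (g x) < \<epsilon>"
    using short [OF x] by blast
  have same: "ends g = ends h \<and> ends g \<noteq> {}"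
    if "x \<in> M" "g \<in> carrier G" "g \<noteq> \<one>" "h \<in> carrier G" "h \<noteq> \<one>" "d x (g x) < \<epsilon>" "d x (h x) < \<epsilon>" for x g h
    using comm [OF that] ends_eq_if_commensurable_commuting [OF that(2-5) _ _ that(1)] by blast
  obtain \<xi> where \<xi>: "\<xi> \<in> ends g"
    using same [OF x g(1,2) g(1,2) g(3,3)] by blast
  have "\<exists>h\<in>carrier G. h \<noteq> \<one> \<and> d y (h y) < \<epsilon> \<and> ends h = ends g" if y: "y \<in> M" for y
    using short [OF y] ends_of_short_elements_const [OF short _ x g y] same by metis
  then have "u \<in> ends g" "v \<in> ends g" "w \<in> ends g"
    using all_gromov_sequences_in_ends [OF _ \<xi>] uvw by metis+
  then show ?thesis using ends_triple g by blast
qed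

end

section \<open>Counting boundary points\<close>

lemma card_le_2_if_no_triple:
  assumes "\<And>a b c. a \<in> A \<Longrightarrow> b \<in> A \<Longrightarrow> c \<in> A \<Longrightarrow> a = b \<or> b = c \<or> a = c"
  shows "finite A \<and> card A \<le> 2"
proof (cases "\<exists>a\<in>A. \<exists>b\<in>A. a \<noteq> b")
  case True
  then obtain a b where "a \<in> A" "b \<in> A" "a \<noteq> b" by blast
  then have "A = {a, b}" using assms [of a b] by blast
  then show ?thesis by (simp add: card_insert_if)
next
  case False
  then have "A = {} \<or> (\<exists>a. A = {a})" by blast
  then show ?thesis by auto
qed

lemma gromov_boundary_card_le_2:
  assumes "Metric_space M d" "hyperbolic M d \<delta>"
    and "\<And>u v w. u \<in> gromov_sequences M d \<Longrightarrow> v \<in> gromov_sequences M d \<Longrightarrow> w \<in> gromov_sequences M d \<Longrightarrow>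
      gromov_asymptotic M d u v \<or> gromov_asymptotic M d v w \<or> gromov_asymptotic M d u w"
  shows "finite (gromov_boundary M d) \<and> card (gromov_boundary M d) \<le> 2"
proof (rule card_le_2_if_no_triple)
  interpret gromov_hyperbolic M d \<delta>
    using assms by (simp add: gromov_hyperbolic_def gromov_hyperbolic_axioms_def)
  let ?GS = "gromov_sequences M d"
  let ?R = "{(u, v). u \<in> ?GS \<and> v \<in> ?GS \<and> gromov_asymptotic M d u v}"
  have eq: "?R `` {u} = ?R `` {v}" if "u \<in> ?GS" "v \<in> ?GS" "gromov_asymptotic M d u v" for u v
  proof -
    have "?R `` {u} \<subseteq> ?R `` {v}" if "u \<in> ?GS" "v \<in> ?GS" "gromov_asymptotic M d u v" for u v
    proof
      fix w assume "w \<in> ?R `` {u}"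
      then have w: "w \<in> ?GS" "gromov_asymptotic M d u w" by auto
      have "gromov_asymptotic M d v w"
        by (rule gromov_asymptotic_trans [OF gromov_asymptotic_sym [OF that(3)] w(2)])
          (use that w gromov_sequences_range in blast)+
      then show "w \<in> ?R `` {v}" using that w by simp
    qed
    then show ?thesis
      using that gromov_asymptotic_sym [OF that(3)] by (intro equalityI)
  qed
  fix a b c assume "a \<in> gromov_boundary M d" "b \<in> gromov_boundary M d" "c \<in> gromov_boundary M d"
  then obtain u v w where uvw: "u \<in> ?GS" "v \<in> ?GS" "w \<in> ?GS"
    and abc: "a = ?R `` {u}" "b = ?R `` {v}" "c = ?R `` {w}"
    unfolding gromov_boundary_def by (auto elim!: quotientE)
  show "a = b \<or> b = c \<or> a = c"
    unfolding abc using assms(3) [OF uvw] eq [OF uvw(1,2)] eq [OF uvw(2,3)] eq [OF uvw(1,3)] by argo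
qed

section \<open>The lower bound for the diastole\<close>

lemma gcb_space_imp_geodesic:
  assumes "gcb_space M d \<sigma>"
  shows "geodesic_metric_space M d"
proof -
  have M: "Metric_space M d" "geodesic_bicombing M d \<sigma>"
    using assms by (simp_all add: gcb_space_def)
  have "\<exists>\<gamma>. \<gamma> \<in> {0..1} \<rightarrow> M \<and> \<gamma> 0 = x \<and> \<gamma> 1 = y \<and>
      (\<forall>s\<in>{0..1}. \<forall>t\<in>{0..1::real}. d (\<gamma> s) (\<gamma> t) = \<bar>s - t\<bar> * d x y)" if "x \<in> M" "y \<in> M" for x y
    using M(2) that unfolding geodesic_bicombing_def by (intro exI [of _ "\<sigma> x y"]) auto
  then show ?thesis
    using M(1) by (simp add: geodesic_metric_space_def geodesic_metric_space_axioms_def)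
qed

lemma isometry_group_apply:
  assumes "g \<in> carrier (isometry_group M d)" "x \<in> M"
  shows "g x \<in> M" "y \<in> M \<Longrightarrow> d (g x) (g y) = d x y"
    "h \<in> carrier (isometry_group M d) \<Longrightarrow> (h \<otimes>\<^bsub>isometry_group M d\<^esub> g) x = h (g x)"
    "\<one>\<^bsub>isometry_group M d\<^esub> x = x"
  using assms Bij_imp_funcset [of g M]
  by (auto simp: isometry_group_def BijGroup_def compose_eq)

lemma hyperbolic_isometry_groupI:
  assumes "Metric_space M d" "hyperbolic M d \<delta>" "discrete_group M d \<Gamma>"
    and "torsion_free ((isometry_group M d)\<lparr>carrier := \<Gamma>\<rparr>)"
  shows "hyperbolic_isometry_group M d \<delta> ((isometry_group M d)\<lparr>carrier := \<Gamma>\<rparr>)"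
proof -
  let ?I = "isometry_group M d"
  have sub: "subgroup \<Gamma> ?I" and fin: "\<And>x R. x \<in> M \<Longrightarrow> 0 \<le> R \<Longrightarrow> finite {g \<in> \<Gamma>. d x (g x) \<le> R}"
    using assms(3) by (auto simp: discrete_group_def)
  note mem = subgroup.mem_carrier [OF sub]
  interpret gromov_hyperbolic M d \<delta>
    using assms by (simp add: gromov_hyperbolic_def gromov_hyperbolic_axioms_def)
  interpret G: group "?I\<lparr>carrier := \<Gamma>\<rparr>"
    by (rule subgroup.subgroup_is_group [OF sub group_isometry_group])
  show ?thesis
  proof
    show "finite {g \<in> carrier (?I\<lparr>carrier := \<Gamma>\<rparr>). d x (g x) \<le> R}" if "x \<in> M" for x R
      \<comment> \<open>\<open>discrete_group\<close> speaks of nonnegative radii only, whence the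
        maximum with 0.\<close>
      by (rule finite_subset [OF _ fin [OF that, of "max 0 R"]]) auto
    show "\<one>\<^bsub>?I\<lparr>carrier := \<Gamma>\<rparr>\<^esub> x = x" if "x \<in> M" for x
      using isometry_group_apply(4) [OF mem [OF subgroup.one_closed [OF sub]] that] by simp
  qed (use assms(4) isometry_group_apply [OF mem] mem in simp_all)
qed

lemma short_elements_commensurable_commuting:
  assumes tf: "torsion_free ((isometry_group M d)\<lparr>carrier := \<Gamma>\<rparr>)" and sub: "subgroup \<Gamma> (isometry_group M d)"
    and nr: "ereal \<epsilon> \<le> nilrad M d \<Gamma> x"
    and g: "g \<in> \<Gamma>" "g \<noteq> \<one>\<^bsub>isometry_group M d\<^esub>" "d x (g x) < \<epsilon>"
    and h: "h \<in> \<Gamma>" "d x (h x) < \<epsilon>"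
  obtains z and k l :: nat where "z \<in> \<Gamma>" "z \<noteq> \<one>\<^bsub>isometry_group M d\<^esub>"
    "0 < k" "g [^]\<^bsub>isometry_group M d\<^esub> k \<otimes>\<^bsub>isometry_group M d\<^esub> z = z \<otimes>\<^bsub>isometry_group M d\<^esub> g [^]\<^bsub>isometry_group M d\<^esub> k"
    "0 < l" "h [^]\<^bsub>isometry_group M d\<^esub> l \<otimes>\<^bsub>isometry_group M d\<^esub> z = z \<otimes>\<^bsub>isometry_group M d\<^esub> h [^]\<^bsub>isometry_group M d\<^esub> l"
proof -
  interpret I: group "isometry_group M d" by (rule group_isometry_group)
  \<comment> \<open>Strictness provides an admissible radius \<open>r\<close> above both
    displacements although the supremum need not be attained.\<close>
  have "ereal (max (d x (g x)) (d x (h x))) < nilrad M d \<Gamma> x"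
    using g(3) h(2) by (intro less_le_trans [OF _ nr]) simp
  then obtain r where r: "max (d x (g x)) (d x (h x)) < r"
      "virtually_nilpotent ((isometry_group M d)\<lparr>carrier := short_subgroup M d \<Gamma> r x\<rparr>)"
    unfolding nilrad_def less_SUP_iff by auto
  let ?S = "short_subgroup M d \<Gamma> r x"
  have "{g \<in> \<Gamma>. d x (g x) \<le> r} \<subseteq> \<Gamma>" by blast
  then have S: "?S \<subseteq> \<Gamma>" "subgroup ?S (isometry_group M d)"
    unfolding short_subgroup_def
    by (rule I.generate_subgroup_incl [OF _ sub])
      (rule I.generate_is_subgroup, use subgroup.subset [OF sub] in auto)
  have gh: "g \<in> ?S" "h \<in> ?S"
    using g h r(1) unfolding short_subgroup_def by (auto intro!: generate.incl)
  interpret S: group "(isometry_group M d)\<lparr>carrier := ?S\<rparr>"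
    by (rule subgroup.subgroup_is_group [OF S(2) group_isometry_group])
  have "torsion_free ((isometry_group M d)\<lparr>carrier := ?S\<rparr>)"
    using tf S(1) unfolding torsion_free_def I.nat_pow_consistent [symmetric] by auto
  then show ?thesis
    by (rule S.virtually_nilpotent_common_commuting [OF r(2), of g h])
      (use that gh g(2) S(1) in \<open>auto simp flip: I.nat_pow_consistent\<close>)
qed

theorem corollary1p4:
  fixes M :: "'a set" and d :: "'a \<Rightarrow> 'a \<Rightarrow> real" and \<sigma> :: "'a bicombing"
    and \<Gamma> :: "('a \<Rightarrow> 'a) set" and P0 r0 \<delta> \<epsilon>0 :: real
  assumes "P0 > 0" and "r0 > 0" and "\<delta> > 0"
    and "margulis_constant TYPE('a) P0 r0 \<epsilon>0"
    and "gcb_space M d \<sigma>"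
    and "hyperbolic M d \<delta>"
    and "packed M d P0 r0"
    and "discrete_group M d \<Gamma>"
    and "\<forall>g\<in>\<Gamma>. sigma_isometry M d \<sigma> g"
    and "torsion_free ((isometry_group M d)\<lparr>carrier := \<Gamma>\<rparr>)"
    and "\<not> elementary M d \<Gamma>"
  shows "dias M d \<Gamma> \<ge> ereal \<epsilon>0"
proof (rule ccontr)
  assume "\<not> ?thesis"
  then have small: "dias M d \<Gamma> < ereal \<epsilon>0" by simp
  let ?I = "isometry_group M d"
  let ?G = "?I\<lparr>carrier := \<Gamma>\<rparr>"
  have MS: "Metric_space M d" using assms(5) by (simp add: gcb_space_def)
  have sub: "subgroup \<Gamma> ?I" using assms(8) by (simp add: discrete_group_def)
  interpret I: group ?I by (rule group_isometry_group)
  interpret packed_hyperbolic_isometry_group M d \<delta> ?G P0 r0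
    using hyperbolic_isometry_groupI [OF MS assms(6,8,10)] gcb_space_imp_geodesic [OF assms(5)] assms(2,7)
    by (simp add: packed_hyperbolic_isometry_group_def packed_hyperbolic_isometry_group_axioms_def)
  have short: "\<exists>g\<in>carrier ?G. g \<noteq> \<one>\<^bsub>?G\<^esub> \<and> d x (g x) < \<epsilon>0" if x: "x \<in> M" for x
  proof -
    \<comment> \<open>The infimum over the empty set is infinite, so this bound also rules out the
      trivial group.\<close>
    have "(INF g \<in> \<Gamma> - {\<one>\<^bsub>?I\<^esub>}. ereal (d x (g x))) < ereal \<epsilon>0"
      using small SUP_upper [OF x, of "\<lambda>x. INF g \<in> \<Gamma> - {\<one>\<^bsub>?I\<^esub>}. ereal (d x (g x))"]
      unfolding dias_def by (rule le_less_trans [rotated])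
    then show ?thesis
      unfolding INF_less_iff by auto
  qed
  have "ereal \<epsilon>0 \<le> nilrad M d \<Gamma> x" if "x \<in> M" for x
    using assms(4,5,7,8) that unfolding margulis_constant_def by blast
  then have comm: "\<exists>z\<in>carrier ?G. z \<noteq> \<one>\<^bsub>?G\<^esub> \<and>
      (\<exists>k>0::nat. g [^]\<^bsub>?G\<^esub> k \<otimes>\<^bsub>?G\<^esub> z = z \<otimes>\<^bsub>?G\<^esub> g [^]\<^bsub>?G\<^esub> k) \<and>
      (\<exists>l>0::nat. h [^]\<^bsub>?G\<^esub> l \<otimes>\<^bsub>?G\<^esub> z = z \<otimes>\<^bsub>?G\<^esub> h [^]\<^bsub>?G\<^esub> l)"
    if "x \<in> M" "g \<in> carrier ?G" "g \<noteq> \<one>\<^bsub>?G\<^esub>" "h \<in> carrier ?G" "h \<noteq> \<one>\<^bsub>?G\<^esub>"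
      "d x (g x) < \<epsilon>0" "d x (h x) < \<epsilon>0" for x g h
    by (rule short_elements_commensurable_commuting [OF assms(10) sub, of \<epsilon>0 x g h])
      (use that in \<open>auto simp flip: I.nat_pow_consistent\<close>)
  have "finite (gromov_boundary M d) \<and> card (gromov_boundary M d) \<le> 2"
    using boundary_at_most_two_points [OF short comm] by (intro gromov_boundary_card_le_2 [OF MS assms(6)])
  moreover have "limit_set M d \<Gamma> x \<subseteq> gromov_boundary M d" for x
    by (auto simp: limit_set_def)
  ultimately have "elementary M d \<Gamma>"
    unfolding elementary_def by (meson card_mono finite_subset order_trans)
  with assms(11) show False by blast
qed

end
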